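(* Let $d\in\mathbb{N}$ and $S=\mathbb{R}^d\setminus\{0\}$. Let $(s_n)_{n\in\mathbb{N}}$ be a sequence of positive real numbers increasing to infinity with $\lim_{n\to\infty}s_{n-1}/s_n=1$, and let $\mu,\nu$ be random measures on $S$ with finite intensities such that $T_{s_n}\nu$ converges vaguely in distribution to $\mu$ as $n\to\infty$. Then $T_t\nu$ converges vaguely in distribution to $\mu$ as $t\to\infty$ ($t$ real), and the limiting random measure $\mu$ is scale-invariant.
   Context: A random measure on $S$ is a random element of the space $\mathcal{M}(S)$ of locally finite non-negative Borel measures on $S$ with the vague topology (generated by the maps $\mu\mapsto\int f\,d\mu$ for $f$ bounded, non-negative, continuous with relatively compact support in $S$). It has finite intensity if $\mathbf{E}\,\xi(A)<\infty$ for every relatively compact Borel set $A\subset S$ (relatively compact in $S$ means bounded and bounded away from $0$). Vague convergence in distribution means convergence in distribution as random elements of $\mathcal{M}(S)$ with the vague topology. For $t>0$ the intrinsic scaling is $T_t\nu(A)=\nu(t^{-1}A)$ for Borel $A\subset S$. A random measure $\mu$ is scale-invariant if $T_c\mu$ has the same distribution as $\mu$ for every $c>0$. *)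

theory Defs
  imports "HOL-Probability.Probability"
begin

text \<open>
  Throughout, \<open>S\<close> is \<open>\<real>\<^sup>d - {0}\<close>, where \<open>\<real>\<^sup>d\<close> is the type \<open>real ^ 'n\<close> with \<open>d = CARD('n)\<close>.
\<close>

abbreviation punctured :: "(real ^ 'n) set" where
  "punctured \<equiv> UNIV - {0}"

abbreviation punctured_borel :: "(real ^ 'n) measure" where
  "punctured_borel \<equiv> restrict_space borel punctured"

definition rel_compact :: "(real ^ 'n) set \<Rightarrow> bool" where
  "rel_compact A \<longleftrightarrow> A \<subseteq> punctured \<and> bounded A \<and> (\<exists>\<epsilon>>0. \<forall>x\<in>A. \<epsilon> \<le> norm x)"

definition lf_measures :: "(real ^ 'n) measure set" where
  "lf_measures = {M. sets M = sets punctured_borel \<and>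
     (\<forall>A\<in>sets punctured_borel. rel_compact A \<longrightarrow> emeasure M A < \<infinity>)}"

text \<open>Only the values of \<open>f\<close> on \<open>S\<close> matter; its value at the origin is arbitrary.\<close>

definition vague_test_fun :: "(real ^ 'n \<Rightarrow> real) \<Rightarrow> bool" where
  "vague_test_fun f \<longleftrightarrow> continuous_on punctured f \<and> bounded (f ` punctured) \<and>
     (\<forall>x\<in>punctured. 0 \<le> f x) \<and> rel_compact {x\<in>punctured. f x \<noteq> 0}"

definition vague_topology :: "(real ^ 'n) measure topology" where
  "vague_topology = topology_generated_by
     {{M\<in>lf_measures. (\<integral>x. f x \<partial>M) \<in> U} | f U. vague_test_fun f \<and> open U}"

definition vague_borel :: "(real ^ 'n) measure measure" where
  "vague_borel = sigma (topspace vague_topology) {U. openin vague_topology U}"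

definition random_measure :: "'p measure \<Rightarrow> ('p \<Rightarrow> (real ^ 'n) measure) \<Rightarrow> bool" where
  "random_measure P \<xi> \<longleftrightarrow> prob_space P \<and> \<xi> \<in> P \<rightarrow>\<^sub>M vague_borel"

definition finite_intensity :: "'p measure \<Rightarrow> ('p \<Rightarrow> (real ^ 'n) measure) \<Rightarrow> bool" where
  "finite_intensity P \<xi> \<longleftrightarrow>
     (\<forall>A\<in>sets punctured_borel. rel_compact A \<longrightarrow> (\<integral>\<^sup>+\<omega>. emeasure (\<xi> \<omega>) A \<partial>P) < \<infinity>)"

text \<open>The random elements \<open>X i\<close> live on \<open>P\<close>, while the limit \<open>Y\<close> may live on another space \<open>Q\<close>.\<close>

definition converges_in_distribution ::
  "'b topology \<Rightarrow> 'p measure \<Rightarrow> ('i \<Rightarrow> 'p \<Rightarrow> 'b) \<Rightarrow> 'i filter \<Rightarrow> 'q measure \<Rightarrow> ('q \<Rightarrow> 'b) \<Rightarrow> bool" where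
  "converges_in_distribution T P X F Q Y \<longleftrightarrow>
     (\<forall>g. continuous_map T euclideanreal g \<and> bounded (g ` topspace T) \<longrightarrow>
        ((\<lambda>i. \<integral>\<omega>. g (X i \<omega>) \<partial>P) \<longlongrightarrow> (\<integral>\<omega>. g (Y \<omega>) \<partial>Q)) F)"

definition dilate :: "real \<Rightarrow> (real ^ 'n) measure \<Rightarrow> (real ^ 'n) measure" where
  "dilate t M = distr M punctured_borel (\<lambda>x. t *\<^sub>R x)"

definition scale_invariant :: "'p measure \<Rightarrow> ('p \<Rightarrow> (real ^ 'n) measure) \<Rightarrow> bool" where
  "scale_invariant P \<xi> \<longleftrightarrow>
     (\<forall>c>0. distr P vague_borel (\<lambda>\<omega>. dilate c (\<xi> \<omega>)) = distr P vague_borel \<xi>)"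

lemma topspace_vague_topology: "topspace vague_topology = (lf_measures :: (real ^ 'n) measure set)"
proof
  have "vague_test_fun (\<lambda>_ :: real ^ 'n. 0)"
    by (auto simp: vague_test_fun_def rel_compact_def image_constant_conv intro: exI[of _ 1])
  hence "(lf_measures :: (real ^ 'n) measure set) \<in>
      {{M\<in>lf_measures. (\<integral>x. f x \<partial>M) \<in> U} | f U. vague_test_fun f \<and> open U}"
    by (intro CollectI exI[of _ "\<lambda>_. 0"] exI[of _ UNIV]) auto
  thus "(lf_measures :: (real ^ 'n) measure set) \<subseteq> topspace vague_topology"
    unfolding vague_topology_def topology_generated_by_topspace by blast
qed (auto simp: vague_topology_def)

lemma space_vague_borel: "space vague_borel = lf_measures"
  using openin_subset[of vague_topology]
  by (subst vague_borel_def, subst space_measure_of) (auto simp: topspace_vague_topology)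

lemma sets_vague_borel: "sets vague_borel = sigma_sets lf_measures {U. openin vague_topology U}"
  using openin_subset[of vague_topology]
  by (subst vague_borel_def, subst sets_measure_of) (auto simp: topspace_vague_topology)

lemma emeasure_dilate:
  fixes M :: "(real ^ 'n) measure"
  assumes "t > 0" and sets: "sets M = sets punctured_borel" and A: "A \<in> sets punctured_borel"
  shows "emeasure (dilate t M) A = emeasure M ((\<lambda>x. inverse t *\<^sub>R x) ` A)"
proof -
  have "(\<lambda>x. t *\<^sub>R x) \<in> punctured_borel \<rightarrow>\<^sub>M (punctured_borel :: (real ^ 'n) measure)"
    using \<open>t > 0\<close> by (intro measurable_restrict_space3) auto
  hence "(\<lambda>x. t *\<^sub>R x) \<in> M \<rightarrow>\<^sub>M punctured_borel"
    using measurable_cong_sets[OF sets refl] by blast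
  moreover have "(\<lambda>x. t *\<^sub>R x) -` A \<inter> space M = (\<lambda>x. inverse t *\<^sub>R x) ` A"
  proof -
    have "A \<subseteq> punctured" "space M = punctured"
      using sets.sets_into_space[OF A] sets_eq_imp_space_eq[OF sets]
      by (auto simp: space_restrict_space)
    thus ?thesis using \<open>t > 0\<close>
      by (force simp: image_iff intro: bexI[where x = "t *\<^sub>R _"])
  qed
  ultimately show ?thesis by (simp add: dilate_def emeasure_distr A)
qed

end

theory Submission
  imports Defs
begin

text \<open>
  Between two consecutive scales of the sequence the dilation factor barely changes: for
  \<open>s n \<le> t < s (Suc n)\<close> one has \<open>dilate t \<nu> = dilate (t / s n) (dilate (s n) \<nu>)\<close>, where
  \<open>t / s n\<close> lies in \<open>{1..1 + \<delta>}\<close> as soon as \<open>n\<close> is large. The limit along the reals therefore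
  reduces to a perturbation statement, which is obtained from upper envelopes. For a
  bounded vaguely continuous \<open>g\<close> let \<open>sup_dilations g \<delta> M\<close> be the supremum
  of \<open>g (dilate c M)\<close> over \<open>c \<in> {1..1 + \<delta>}\<close>. Dilation is jointly continuous in the factor and the
  measure (\<open>continuous_map_dilate_joint\<close>) and \<open>{1..1 + \<delta>}\<close> is compact, so the envelope is again
  bounded and vaguely continuous (\<open>continuous_map_SUP_compact\<close>): the convergence that is assumed
  along \<open>s\<close> applies to it and bounds the limit superior of \<open>E g (dilate t \<nu>)\<close> by
  \<open>E sup_dilations g \<delta> \<mu>\<close>. The envelopes decrease to \<open>g\<close> as \<open>\<delta>\<close> tends to \<open>0\<close>, so dominated
  convergence turns this bound into \<open>E g \<mu>\<close>; applied to \<open>- g\<close>, the same argument bounds the limit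
  inferior.

  Given convergence along the reals, \<open>t\<close> and \<open>c * t\<close> give the same limit, whereas dilating by
  \<open>c\<close> is continuous; hence \<open>E g (dilate c \<mu>) = E g \<mu>\<close> for every bounded continuous \<open>g\<close>. Equality
  of the laws on the Borel sets does not follow in an arbitrary topological space, where continuous
  functions see only the Baire sets. In the vague topology every open set is a countable union of
  cozero sets, because the topology has a countable subbase of cozero sets
  (\<open>vague_countable_cozero_subbase\<close>), and this yields \<open>distr_vague_borel_eqI\<close>.
\<close>

section \<open>Test functions and vague continuity\<close>

lemma vague_test_fun_continuous_on: "vague_test_fun f \<Longrightarrow> continuous_on punctured f"
  by (simp add: vague_test_fun_def)

lemma vague_test_fun_measurable:
  assumes "vague_test_fun f" and "sets M = sets punctured_borel"
  shows "f \<in> borel_measurable M"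
proof -
  have "f \<in> borel_measurable punctured_borel"
    using assms(1) unfolding vague_test_fun_def
    by (intro borel_measurable_continuous_on_restrict) auto
  then show ?thesis
    using measurable_cong_sets[OF assms(2) refl] by blast
qed

lemma lf_measures_space: "M \<in> lf_measures \<Longrightarrow> space M = punctured"
  unfolding lf_measures_def by (auto dest!: sets_eq_imp_space_eq simp: space_restrict_space)

lemma lf_measures_sets: "M \<in> lf_measures \<Longrightarrow> sets M = sets punctured_borel"
  unfolding lf_measures_def by auto

lemma vague_test_fun_integrable:
  assumes f: "vague_test_fun f" and M: "M \<in> lf_measures"
  shows "integrable M f"
proof -
  let ?A = "{x\<in>punctured. f x \<noteq> 0}"
  have meas: "f \<in> borel_measurable M"
    using f lf_measures_sets[OF M] by (rule vague_test_fun_measurable)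
  have A: "?A \<in> sets M"
    using meas unfolding lf_measures_space[OF M, symmetric] by measurable
  have fin: "emeasure M ?A < \<infinity>"
    using M f A unfolding lf_measures_def vague_test_fun_def by auto
  obtain B where "\<And>x. x \<in> punctured \<Longrightarrow> norm (f x) \<le> B"
    using f unfolding vague_test_fun_def bounded_iff by blast
  then show ?thesis
    by (intro integrableI_bounded_set[OF A meas fin, of B] AE_I2)
       (auto simp: lf_measures_space[OF M])
qed

lemma vague_integral_mono:
  assumes "vague_test_fun f" "vague_test_fun g" "M \<in> lf_measures"
    and "\<And>x. x \<in> punctured \<Longrightarrow> f x \<le> g x"
  shows "(\<integral>x. f x \<partial>M) \<le> (\<integral>x. g x \<partial>M)"
  using assms by (intro integral_mono) (auto intro: vague_test_fun_integrable simp: lf_measures_space)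

lemma vague_integral_nonneg:
  assumes "vague_test_fun f" "M \<in> lf_measures"
  shows "0 \<le> (\<integral>x. f x \<partial>M)"
  using assms by (intro integral_nonneg_AE AE_I2) (auto simp: vague_test_fun_def lf_measures_space)

lemma continuous_map_vague_integral:
  fixes f :: "real ^ 'n \<Rightarrow> real"
  assumes "vague_test_fun f"
  shows "continuous_map vague_topology euclideanreal (\<lambda>M. \<integral>x. f x \<partial>M)"
  unfolding continuous_map topspace_vague_topology
proof (intro conjI allI impI)
  fix U :: "real set" assume "openin euclideanreal U"
  then show "openin vague_topology {M \<in> lf_measures. (\<integral>x. f x \<partial>M) \<in> U}"
    using assms unfolding vague_topology_def by (intro topology_generated_by_Basis) auto
qed auto

text \<open>
  The vague topology is the initial topology of the integrals of test functions, hence its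
  universal property.
\<close>
lemma continuous_map_into_vague:
  fixes F :: "'a \<Rightarrow> (real ^ 'n) measure"
  assumes "\<And>x. x \<in> topspace X \<Longrightarrow> F x \<in> lf_measures"
    and cont: "\<And>f. vague_test_fun f \<Longrightarrow> continuous_map X euclideanreal (\<lambda>x. \<integral>y. f y \<partial>F x)"
  shows "continuous_map X vague_topology F"
  unfolding vague_topology_def
proof (rule continuous_on_generated_topo)
  fix W :: "(real ^ 'n) measure set"
  assume "W \<in> {{M\<in>lf_measures. (\<integral>x. f x \<partial>M) \<in> U} | f U. vague_test_fun f \<and> open U}"
  then obtain f U where W: "W = {M\<in>lf_measures. (\<integral>x. f x \<partial>M) \<in> U}" "vague_test_fun f" "open U"
    by auto
  have "openin X {x \<in> topspace X. (\<integral>y. f y \<partial>F x) \<in> U}"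
    using cont[OF W(2)] W(3) by (intro openin_continuous_map_preimage) auto
  moreover have "F -` W \<inter> topspace X = {x \<in> topspace X. (\<integral>y. f y \<partial>F x) \<in> U}"
    using assms(1) W by auto
  ultimately show "openin X (F -` W \<inter> topspace X)" by simp
next
  have "\<Union>{{M\<in>lf_measures. (\<integral>x. f x \<partial>M) \<in> U} | f U. vague_test_fun f \<and> open U} = (lf_measures :: (real ^ 'n) measure set)"
    using topspace_vague_topology[where 'n='n] unfolding vague_topology_def by simp
  then show "F ` topspace X \<subseteq> \<Union>{{M\<in>lf_measures. (\<integral>x. f x \<partial>M) \<in> U} | f U. vague_test_fun f \<and> open U}"
    using assms(1) by auto
qed

text \<open>
  For positive \<open>k\<close>, a trapezoidal function of the norm that dominates the indicator of the annulus of radii \<open>1 / k\<close>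
  and \<open>k\<close> and vanishes outside the annulus of radii \<open>1 / (2 * k)\<close> and \<open>2 * k\<close>. The cutoffs make the mass near
  a given compact set a continuous function of the measure; indexing them by naturals keeps the
  family countable.
\<close>
definition annulus_cutoff :: "nat \<Rightarrow> real ^ 'n \<Rightarrow> real" where
  "annulus_cutoff k x = max 0 (min (min 1 (2 * real k * norm x - 1)) (2 * real k - norm x))"

lemma annulus_cutoff_bounds: "0 \<le> annulus_cutoff k x" "annulus_cutoff k x \<le> 1"
  by (auto simp: annulus_cutoff_def)

lemma annulus_cutoff_eq_1:
  assumes "0 < k" "1 / real k \<le> norm x" "norm x \<le> real k"
  shows "annulus_cutoff k x = 1"
proof -
  have "2 * real k * norm x \<ge> 2" "real k \<ge> 1" using assms by (auto simp: field_simps)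
  then show ?thesis using assms(3) by (auto simp: annulus_cutoff_def)
qed

lemma vague_test_fun_annulus_cutoff:
  fixes k :: nat
  assumes "0 < k"
  shows "vague_test_fun (annulus_cutoff k :: real ^ 'n \<Rightarrow> real)"
  unfolding vague_test_fun_def
proof (intro conjI)
  show "continuous_on punctured (annulus_cutoff k)"
    unfolding annulus_cutoff_def by (intro continuous_intros)
  show "bounded (annulus_cutoff k ` punctured)"
    by (auto simp: bounded_iff abs_le_iff annulus_cutoff_bounds intro!: exI[of _ 1] order_trans[OF _ annulus_cutoff_bounds(1)])
  show "rel_compact {x \<in> punctured. annulus_cutoff k (x :: real ^ 'n) \<noteq> 0}"
    unfolding rel_compact_def
  proof (intro conjI)
    show "bounded {x \<in> punctured. annulus_cutoff k (x :: real ^ 'n) \<noteq> 0}"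
      by (auto simp: bounded_iff annulus_cutoff_def max_def min_def intro!: exI[of _ "2 * real k"] split: if_splits)
    have "1 / (2 * real k) \<le> norm x" if "annulus_cutoff k x \<noteq> 0" for x :: "real ^ 'n"
    proof -
      have "2 * real k * norm x - 1 > 0" using that by (auto simp: annulus_cutoff_def max_def split: if_splits)
      then show ?thesis using assms by (auto simp: field_simps)
    qed
    then have "\<forall>x\<in>{x \<in> punctured. annulus_cutoff k x \<noteq> 0}. 1 / (2 * real k) \<le> norm (x :: real ^ 'n)"
      by blast
    moreover have "0 < 1 / (2 * real k)" using assms by simp
    ultimately show "\<exists>\<epsilon>>0. \<forall>x\<in>{x \<in> punctured. annulus_cutoff k x \<noteq> 0}. \<epsilon> \<le> norm (x :: real ^ 'n)"
      by blast
  qed auto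
qed (auto simp: annulus_cutoff_bounds)

lemma rel_compact_in_annulus:
  assumes "rel_compact A"
  obtains r R where "0 < r" "0 < R" "\<forall>x\<in>A. r \<le> norm x \<and> norm x \<le> R"
  using assms unfolding rel_compact_def bounded_pos by metis

lemma vague_test_fun_in_annulus:
  fixes f :: "real ^ 'n \<Rightarrow> real"
  assumes "vague_test_fun f"
  obtains r R where "0 < r" "0 < R"
    "\<forall>x\<in>punctured. f x \<noteq> 0 \<longrightarrow> r \<le> norm x \<and> norm x \<le> R"
proof -
  have "rel_compact {x\<in>punctured. f x \<noteq> 0}"
    using assms unfolding vague_test_fun_def by auto
  from rel_compact_in_annulus[OF this] that show thesis by (smt (verit) mem_Collect_eq)
qed

lemma exists_annulus_index:
  fixes r R :: real
  assumes "0 < r"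
  obtains k :: nat where "0 < k" "1 / real k \<le> r" "R \<le> real k"
proof -
  obtain k :: nat where k: "max 1 (max (1 / r) R) \<le> real k" using real_arch_simple by blast
  then have "0 < k" by (cases k) auto
  moreover have "1 / real k \<le> r" using k assms \<open>0 < k\<close> by (auto simp: field_simps)
  ultimately show ?thesis using that k by auto
qed

section \<open>Joint continuity of dilation\<close>

lemma dilate_in_lf_measures:
  fixes M :: "(real ^ 'n) measure"
  assumes t: "0 < t" and M: "M \<in> lf_measures"
  shows "dilate t M \<in> lf_measures"
  unfolding lf_measures_def
proof (intro CollectI conjI ballI impI)
  show "sets (dilate t M) = sets punctured_borel" by (simp add: dilate_def)
next
  fix A :: "(real ^ 'n) set" assume A: "A \<in> sets punctured_borel" and rc: "rel_compact A"
  let ?B = "(\<lambda>x. inverse t *\<^sub>R x) ` A"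
  obtain r R where rR: "0 < r" "0 < R" "\<forall>x\<in>A. r \<le> norm x \<and> norm x \<le> R"
    using rel_compact_in_annulus[OF rc] by metis
  have "bounded ?B"
    using rR t by (auto simp: bounded_iff field_simps intro!: exI[of _ "R / t"])
  then have "rel_compact ?B"
    using rR t rc unfolding rel_compact_def
    by (auto simp: field_simps intro!: exI[of _ "r / t"])
  moreover have "?B \<in> sets punctured_borel"
  proof -
    have "(\<lambda>x. t *\<^sub>R x) \<in> punctured_borel \<rightarrow>\<^sub>M (punctured_borel :: (real ^ 'n) measure)"
      using t by (intro measurable_restrict_space3) auto
    from measurable_sets[OF this A] show ?thesis
    proof (rule back_subst[where P = "\<lambda>X. X \<in> _"])
      show "(\<lambda>x. t *\<^sub>R x) -` A \<inter> space punctured_borel = ?B"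
        using sets.sets_into_space[OF A] t
        by (force simp: space_restrict_space image_iff intro: bexI[where x = "t *\<^sub>R _"])
    qed
  qed
  ultimately have "emeasure M ?B < \<infinity>" using M by (auto simp: lf_measures_def)
  then show "emeasure (dilate t M) A < \<infinity>"
    using emeasure_dilate[OF t lf_measures_sets[OF M] A] by simp
qed

lemma measurable_scaleR_lf_measures:
  fixes M :: "(real ^ 'n) measure"
  assumes "0 < t" "M \<in> lf_measures"
  shows "(\<lambda>x. t *\<^sub>R x) \<in> M \<rightarrow>\<^sub>M punctured_borel"
proof -
  have "(\<lambda>x. t *\<^sub>R x) \<in> punctured_borel \<rightarrow>\<^sub>M (punctured_borel :: (real ^ 'n) measure)"
    using assms by (intro measurable_restrict_space3) auto
  then show ?thesis
    using measurable_cong_sets[OF lf_measures_sets[OF assms(2)] refl] by blast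
qed

lemma integral_dilate:
  assumes "0 < t" "M \<in> lf_measures" "vague_test_fun f"
  shows "(\<integral>x. f x \<partial>dilate t M) = (\<integral>x. f (t *\<^sub>R x) \<partial>M)"
  unfolding dilate_def
  by (rule integral_distr[OF measurable_scaleR_lf_measures[OF assms(1,2)]
        vague_test_fun_measurable[OF assms(3) refl]])

lemma dilate_dilate:
  assumes "0 < a" "0 < b" "M \<in> lf_measures"
  shows "dilate a (dilate b M) = dilate (a * b) M"
proof -
  have "dilate a (dilate b M) = distr M punctured_borel ((\<lambda>x. a *\<^sub>R x) \<circ> (\<lambda>x. b *\<^sub>R x))"
    unfolding dilate_def
    using assms by (intro distr_distr measurable_scaleR_lf_measures measurable_restrict_space3) auto
  then show ?thesis by (simp add: dilate_def comp_def)
qed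

lemma dilate_one: "M \<in> lf_measures \<Longrightarrow> dilate 1 M = M"
  using distr_id2[of punctured_borel M] by (simp add: dilate_def id_def lf_measures_sets)

text \<open>
  For \<open>c\<close> between \<open>c0 / 2\<close> and \<open>2 * c0\<close>, all functions \<open>f (c *\<^sub>R x)\<close> are supported in one compact
  annulus \<open>K\<close>, on which \<open>(c, x) \<mapsto> f (c *\<^sub>R x)\<close> is uniformly continuous. The error is stated with the
  cutoff, and not with the indicator of \<open>K\<close>, so that its integral is controlled on a vague
  neighbourhood. The index \<open>k\<close> does not depend on \<open>\<eta>\<close>, so the neighbourhood of the measure can
  be chosen before \<open>\<eta>\<close>.
\<close>
lemma dilated_test_fun_uniform:
  fixes f :: "real ^ 'n \<Rightarrow> real"
  assumes f: "vague_test_fun f" and c0: "0 < c0"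
  obtains k where "0 < k"
    and "\<And>\<eta>. 0 < \<eta> \<Longrightarrow> \<exists>\<delta>>0. \<forall>c. \<bar>c - c0\<bar> < \<delta> \<longrightarrow>
      (\<forall>x\<in>punctured. \<bar>f (c *\<^sub>R x) - f (c0 *\<^sub>R x)\<bar> \<le> \<eta> * annulus_cutoff k x)"
proof -
  obtain r R where rR: "0 < r" "0 < R"
      "\<forall>x\<in>punctured. f x \<noteq> 0 \<longrightarrow> r \<le> norm x \<and> norm x \<le> R"
    using vague_test_fun_in_annulus[OF f] by metis
  obtain k :: nat where k: "0 < k" "1 / real k \<le> r / (2 * c0)" "2 * R / c0 \<le> real k"
    using exists_annulus_index[of "r / (2 * c0)" "2 * R / c0"] rR c0 by auto
  define K :: "(real ^ 'n) set" where "K = cball 0 (real k) - ball 0 (1 / real k)"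
  have K: "x \<in> K \<longleftrightarrow> 1 / real k \<le> norm x \<and> norm x \<le> real k" for x
    by (auto simp: K_def)
  have Kp: "x \<noteq> 0" if "x \<in> K" for x using that k by (auto simp: K)
  have "compact ({c0/2..2*c0} \<times> K)"
    unfolding K_def by (intro compact_Times compact_diff) auto
  moreover have "continuous_on ({c0/2..2*c0} \<times> K) (\<lambda>p. f (fst p *\<^sub>R snd p))"
    using c0 Kp by (intro continuous_on_compose2[OF vague_test_fun_continuous_on[OF f]])
      (auto intro!: continuous_on_scaleR continuous_on_fst continuous_on_snd continuous_on_id)
  ultimately have uc: "uniformly_continuous_on ({c0/2..2*c0} \<times> K) (\<lambda>p. f (fst p *\<^sub>R snd p))"
    by (rule compact_uniformly_continuous[rotated])
  have outside: "f (c *\<^sub>R x) = 0" if "c \<in> {c0/2..2*c0}" "x \<in> punctured" "x \<notin> K" for c x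
  proof (rule ccontr)
    assume nz: "f (c *\<^sub>R x) \<noteq> 0"
    have cpos: "0 < c" using that c0 by auto
    have *: "r \<le> c * norm x" "c * norm x \<le> R"
      using rR(3)[rule_format, of "c *\<^sub>R x"] nz that cpos by auto
    have "r \<le> (2 * c0) * norm x" using *(1) mult_right_mono[of c "2*c0" "norm x"] that(1) by (meson atLeastAtMost_iff norm_ge_zero order_trans)
    then have "r / (2 * c0) \<le> norm x" using c0 by (simp add: divide_le_eq ac_simps)
    then have "1 / real k \<le> norm x" using k(2) by linarith
    moreover have "(c0/2) * norm x \<le> R" using *(2) mult_right_mono[of "c0/2" c "norm x"] that(1) by (meson atLeastAtMost_iff norm_ge_zero order_trans)
    then have "norm x \<le> 2 * R / c0" using c0 by (simp add: field_simps)
    then have "norm x \<le> real k" using k(3) by linarith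
    ultimately show False using that(3) K by auto
  qed
  show thesis
  proof (rule that[OF k(1)])
    fix \<eta> :: real assume \<eta>: "0 < \<eta>"
    obtain d where d: "0 < d" "\<And>p q. p \<in> {c0/2..2*c0} \<times> K \<Longrightarrow> q \<in> {c0/2..2*c0} \<times> K \<Longrightarrow>
        dist q p < d \<Longrightarrow> dist (f (fst q *\<^sub>R snd q)) (f (fst p *\<^sub>R snd p)) < \<eta>"
      using uc \<eta> unfolding uniformly_continuous_on_def by metis
    show "\<exists>\<delta>>0. \<forall>c. \<bar>c - c0\<bar> < \<delta> \<longrightarrow>
      (\<forall>x\<in>punctured. \<bar>f (c *\<^sub>R x) - f (c0 *\<^sub>R x)\<bar> \<le> \<eta> * annulus_cutoff k x)"
    proof (intro exI[of _ "min d (c0/2)"] conjI allI impI ballI)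
      show "0 < min d (c0/2)" using d c0 by auto
      fix c x assume c: "\<bar>c - c0\<bar> < min d (c0/2)" and x: "x \<in> (punctured :: (real ^ 'n) set)"
      have c': "c \<in> {c0/2..2*c0}" "c0 \<in> {c0/2..2*c0}" using c c0 unfolding min_less_iff_conj atLeastAtMost_iff by linarith+
      show "\<bar>f (c *\<^sub>R x) - f (c0 *\<^sub>R x)\<bar> \<le> \<eta> * annulus_cutoff k x"
      proof (cases "x \<in> K")
        case True
        have "dist (f (c *\<^sub>R x)) (f (c0 *\<^sub>R x)) < \<eta>"
          using d(2)[of "(c0, x)" "(c, x)"] c c' True by (auto simp: dist_Pair_Pair dist_real_def)
        moreover have "annulus_cutoff k x = 1"
          using True k(1) by (intro annulus_cutoff_eq_1) (auto simp: K)
        ultimately show ?thesis by (auto simp: dist_real_def)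
      next
        case False
        then show ?thesis using outside[OF c'(1) x] outside[OF c'(2) x] \<eta> annulus_cutoff_bounds(1)[of k x]
          by auto
      qed
    qed
  qed
qed

lemma vague_test_fun_scaleR:
  fixes f :: "real ^ 'n \<Rightarrow> real"
  assumes f: "vague_test_fun f" and c: "0 < c"
  shows "vague_test_fun (\<lambda>x. f (c *\<^sub>R x))"
  unfolding vague_test_fun_def
proof (intro conjI)
  show "continuous_on punctured (\<lambda>x. f (c *\<^sub>R x))"
    using c by (intro continuous_on_compose2[OF vague_test_fun_continuous_on[OF f]])
      (auto intro: continuous_on_scaleR continuous_on_const continuous_on_id)
  show "bounded ((\<lambda>x. f (c *\<^sub>R x)) ` punctured)"
    using f c unfolding vague_test_fun_def by (auto intro: bounded_subset)
  show "\<forall>x\<in>punctured. 0 \<le> f (c *\<^sub>R x)"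
    using f c unfolding vague_test_fun_def by auto
  obtain r R where rR: "0 < r" "0 < R"
      "\<forall>x\<in>punctured. f x \<noteq> 0 \<longrightarrow> r \<le> norm x \<and> norm x \<le> R"
    using vague_test_fun_in_annulus[OF f] by metis
  have *: "r / c \<le> norm x \<and> norm x \<le> R / c" if "x \<noteq> 0" "f (c *\<^sub>R x) \<noteq> 0" for x
    using rR(3)[rule_format, of "c *\<^sub>R x"] that c by (auto simp: field_simps)
  have "bounded {x \<in> punctured. f (c *\<^sub>R x) \<noteq> 0}"
    unfolding bounded_iff using * by blast
  moreover have "\<forall>x\<in>{x \<in> punctured. f (c *\<^sub>R x) \<noteq> 0}. r / c \<le> norm x"
    using * by blast
  moreover have "0 < r / c" using rR(1) c by simp
  ultimately show "rel_compact {x \<in> punctured. f (c *\<^sub>R x) \<noteq> 0}"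
    unfolding rel_compact_def by blast
qed

text \<open>
  Near \<open>(c0, M0)\<close> the integral of \<open>f\<close> against \<open>dilate c M\<close> differs from the integral of
  \<open>f (c0 *\<^sub>R x)\<close> against \<open>M\<close> by at most \<open>\<eta>\<close> times the integral of a cutoff. The latter stays below
  \<open>m\<close> for \<open>M\<close> in a vague neighbourhood of \<open>M0\<close>, and the integral of \<open>f (c0 *\<^sub>R x)\<close>, itself a test
  function, is continuous in \<open>M\<close>.
\<close>
lemma continuous_map_dilate_joint:
  "continuous_map (prod_topology (top_of_set {0<..}) vague_topology) vague_topology
     (\<lambda>(c, M :: (real ^ 'n) measure). dilate c M)"
proof (rule continuous_map_into_vague)
  let ?X = "prod_topology (top_of_set {0::real<..}) (vague_topology :: (real ^ 'n) measure topology)"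
  show "(\<lambda>(c, M). dilate c M) p \<in> lf_measures" if "p \<in> topspace ?X" for p
    using that by (auto simp: topspace_vague_topology dilate_in_lf_measures)
  fix f :: "real ^ 'n \<Rightarrow> real" assume f: "vague_test_fun f"
  let ?I = "\<lambda>p. \<integral>y. f y \<partial>(case p of (c, M) \<Rightarrow> dilate c M)"
  have "\<exists>U. openin ?X U \<and> p \<in> U \<and> (\<forall>q\<in>U. ?I q \<in> V)"
    if p: "p \<in> topspace ?X" and V: "open V" "?I p \<in> V" for p V
  proof -
    obtain c0 M0 where p_eq: "p = (c0, M0)" and c0: "0 < c0" and M0: "M0 \<in> lf_measures"
      using p by (cases p) (auto simp: topspace_vague_topology)
    obtain e where e: "0 < e" "\<And>y. dist y (?I p) < e \<Longrightarrow> y \<in> V"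
      using V unfolding open_dist by blast
    obtain k where k: "0 < k"
      and unif: "\<And>\<eta>. 0 < \<eta> \<Longrightarrow> \<exists>\<delta>>0. \<forall>c. \<bar>c - c0\<bar> < \<delta> \<longrightarrow>
        (\<forall>x\<in>punctured. \<bar>f (c *\<^sub>R x) - f (c0 *\<^sub>R x)\<bar> \<le> \<eta> * annulus_cutoff k x)"
      using dilated_test_fun_uniform[OF f c0] by metis
    let ?\<phi> = "annulus_cutoff k :: real ^ 'n \<Rightarrow> real"
    note \<phi> = vague_test_fun_annulus_cutoff[OF k]
    \<comment> \<open>Adding 1 makes \<open>m\<close> positive and leaves room for a neighbourhood of \<open>M0\<close>.\<close>
    define m where "m = (\<integral>x. ?\<phi> x \<partial>M0) + 1"
    have m: "0 < m" using vague_integral_nonneg[OF \<phi> M0] by (simp add: m_def)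
    obtain \<delta> where \<delta>: "0 < \<delta>" "\<And>c x. \<bar>c - c0\<bar> < \<delta> \<Longrightarrow> x \<in> punctured \<Longrightarrow>
        \<bar>f (c *\<^sub>R x) - f (c0 *\<^sub>R x)\<bar> \<le> (e / (2 * m)) * ?\<phi> x"
      using unif[of "e / (2 * m)"] e m by auto
    define A where "A = {0<..} \<inter> ball c0 \<delta>"
    define B where "B = {M \<in> lf_measures. (\<integral>x. ?\<phi> x \<partial>M) \<in> {..<m}} \<inter>
      {M \<in> lf_measures. (\<integral>x. f (c0 *\<^sub>R x) \<partial>M) \<in> ball (?I p) (e/2)}"
    have fc0: "vague_test_fun (\<lambda>x. f (c0 *\<^sub>R x))"
      using f c0 by (rule vague_test_fun_scaleR)
    have "openin (vague_topology :: (real ^ 'n) measure topology) B"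
      unfolding B_def topspace_vague_topology[symmetric]
      using continuous_map_vague_integral[OF \<phi>] continuous_map_vague_integral[OF fc0]
      by (intro openin_Int openin_continuous_map_preimage) auto
    moreover have "openin (top_of_set {0<..}) A"
      unfolding A_def by (intro openin_open_Int) auto
    ultimately have "openin ?X (A \<times> B)"
      by (auto simp: openin_prod_Times_iff)
    moreover have "p \<in> A \<times> B"
      using c0 M0 \<delta>(1) e(1) by (auto simp: p_eq A_def B_def m_def integral_dilate[OF c0 M0 f])
    moreover have "?I q \<in> V" if "q \<in> A \<times> B" for q
    proof -
      obtain c M where q: "q = (c, M)" by (cases q)
      have c: "0 < c" "\<bar>c - c0\<bar> < \<delta>" and M: "M \<in> lf_measures" "(\<integral>x. ?\<phi> x \<partial>M) < m"
        and close: "dist (\<integral>x. f (c0 *\<^sub>R x) \<partial>M) (?I p) < e / 2"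
        using that by (auto simp: q A_def B_def dist_real_def dist_commute abs_minus_commute)
      have fc: "vague_test_fun (\<lambda>x. f (c *\<^sub>R x))" using f c(1) by (rule vague_test_fun_scaleR)
      have "\<bar>(\<integral>x. f (c *\<^sub>R x) \<partial>M) - (\<integral>x. f (c0 *\<^sub>R x) \<partial>M)\<bar>
          = \<bar>\<integral>x. f (c *\<^sub>R x) - f (c0 *\<^sub>R x) \<partial>M\<bar>"
        using fc fc0 M by (subst Bochner_Integration.integral_diff) (auto intro: vague_test_fun_integrable)
      also have "\<dots> \<le> (\<integral>x. \<bar>f (c *\<^sub>R x) - f (c0 *\<^sub>R x)\<bar> \<partial>M)"
        by (rule integral_abs_bound)
      also have "\<dots> \<le> (\<integral>x. (e / (2 * m)) * ?\<phi> x \<partial>M)"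
        using fc fc0 M \<phi> c(2)
        by (intro integral_mono integrable_abs Bochner_Integration.integrable_diff integrable_mult_right)
           (use \<delta>(2) in \<open>auto intro!: vague_test_fun_integrable simp: lf_measures_space\<close>)
      also have "\<dots> = (e / (2 * m)) * (\<integral>x. ?\<phi> x \<partial>M)" by simp
      also have "\<dots> \<le> (e / (2 * m)) * m"
        using M(2) e(1) m by (intro mult_left_mono) auto
      also have "\<dots> = e / 2" using m by simp
      finally have "dist (\<integral>x. f (c *\<^sub>R x) \<partial>M) (?I p) < e"
        using close unfolding dist_real_def by linarith
      then show ?thesis by (intro e(2)) (simp add: q integral_dilate[OF c(1) M(1) f])
    qed
    ultimately show ?thesis by blast
  qed
  then show "continuous_map ?X euclideanreal ?I"
    unfolding continuous_map_eq_topcontinuous_at topcontinuous_at_def by auto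
qed

lemma continuous_map_dilate:
  assumes c: "0 < c"
  shows "continuous_map vague_topology vague_topology (dilate c :: (real ^ 'n) measure \<Rightarrow> _)"
proof (rule continuous_map_into_vague)
  fix f :: "real ^ 'n \<Rightarrow> real" assume f: "vague_test_fun f"
  show "continuous_map vague_topology euclideanreal (\<lambda>M. \<integral>y. f y \<partial>dilate c M)"
    using continuous_map_vague_integral[OF vague_test_fun_scaleR[OF f c]]
    by (rule continuous_map_eq) (simp add: topspace_vague_topology integral_dilate c f)
qed (auto simp: topspace_vague_topology dilate_in_lf_measures c)

section \<open>Suprema over a compact parameter\<close>

text \<open>
  The superlevel sets of the supremum are projections of open sets, and projections are open maps.
  The sublevel sets are complements of projections of closed sets, because the supremum is attained;
  along a compact factor projections are closed maps.
\<close>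
lemma continuous_map_SUP_compact:
  fixes h :: "'a::topological_space \<Rightarrow> 'b \<Rightarrow> real"
  assumes K: "compact K" "K \<noteq> {}"
    and cont: "continuous_map (prod_topology (top_of_set K) X) euclideanreal (\<lambda>(c, x). h c x)"
  shows "continuous_map X euclideanreal (\<lambda>x. SUP c\<in>K. h c x)"
proof -
  let ?X = "prod_topology (top_of_set K) X"
  have attained: "\<exists>c\<in>K. (SUP c\<in>K. h c x) = h c x \<and> (\<forall>b\<in>K. h b x \<le> h c x)" if "x \<in> topspace X" for x
  proof -
    have "continuous_map (top_of_set K) euclideanreal ((\<lambda>(c, x). h c x) \<circ> (\<lambda>c. (c, x)))"
      using that by (intro continuous_map_compose[OF _ cont] continuous_map_pairedI)
        (auto simp: continuous_map_id[unfolded id_def])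
    then have "continuous_on K (\<lambda>c. h c x)" by (simp add: comp_def)
    then obtain c where c: "c \<in> K" "\<forall>b\<in>K. h b x \<le> h c x"
      using continuous_attains_sup[OF K] by metis
    then have "(SUP c\<in>K. h c x) = h c x" by (intro cSup_eq_maximum) auto
    then show ?thesis using c by blast
  qed
  have "openin X {x \<in> topspace X. a < (SUP c\<in>K. h c x)}" for a
  proof -
    have "openin ?X {p \<in> topspace ?X. (case p of (c, x) \<Rightarrow> h c x) \<in> {a<..}}"
      by (rule openin_continuous_map_preimage[OF cont]) auto
    then have "openin X (snd ` {p \<in> topspace ?X. (case p of (c, x) \<Rightarrow> h c x) \<in> {a<..}})"
      using open_map_snd unfolding open_map_def by blast
    moreover have "snd ` {p \<in> topspace ?X. (case p of (c, x) \<Rightarrow> h c x) \<in> {a<..}}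
        = {x \<in> topspace X. \<exists>c\<in>K. a < h c x}"
      by (force simp: image_iff)
    moreover have "\<dots> = {x \<in> topspace X. a < (SUP c\<in>K. h c x)}"
      using attained by (intro Collect_cong conj_cong refl) (metis less_le_trans)
    ultimately show ?thesis by simp
  qed
  moreover have "openin X {x \<in> topspace X. (SUP c\<in>K. h c x) < a}" for a
  proof -
    have "closedin ?X {p \<in> topspace ?X. (case p of (c, x) \<Rightarrow> h c x) \<in> {a..}}"
      by (rule closedin_continuous_map_preimage[OF cont]) auto
    moreover have "closed_map ?X X snd"
      using K(1) by (intro Abstract_Topological_Spaces.closed_map_snd) (simp add: compact_space_subtopology)
    ultimately have "closedin X (snd ` {p \<in> topspace ?X. (case p of (c, x) \<Rightarrow> h c x) \<in> {a..}})"
      unfolding closed_map_def by blast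
    moreover have "snd ` {p \<in> topspace ?X. (case p of (c, x) \<Rightarrow> h c x) \<in> {a..}}
        = {x \<in> topspace X. \<exists>c\<in>K. a \<le> h c x}"
      by (force simp: image_iff)
    ultimately have "openin X (topspace X - {x \<in> topspace X. \<exists>c\<in>K. a \<le> h c x})"
      by (simp add: openin_diff)
    moreover have "topspace X - {x \<in> topspace X. \<exists>c\<in>K. a \<le> h c x} = {x \<in> topspace X. (SUP c\<in>K. h c x) < a}"
    proof -
      have "(\<not> (\<exists>c\<in>K. a \<le> h c x)) \<longleftrightarrow> (SUP c\<in>K. h c x) < a" if "x \<in> topspace X" for x
        using attained[OF that] by fastforce
      then show ?thesis by blast
    qed
    ultimately show ?thesis by simp
  qed
  ultimately show ?thesis
    unfolding continuous_map_upper_lower_semicontinuous_lt by blast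
qed

section \<open>Measurability and expectations of random measures\<close>

lemma continuous_map_measurable_vague_borel:
  assumes "continuous_map vague_topology euclideanreal g"
  shows "g \<in> borel_measurable (vague_borel :: (real ^ 'n) measure measure)"
proof (rule borel_measurableI)
  fix S :: "real set" assume "open S"
  then have "openin vague_topology {M \<in> lf_measures. g M \<in> S}"
    using openin_continuous_map_preimage[OF assms] by (auto simp: topspace_vague_topology)
  moreover have "g -` S \<inter> space vague_borel = {M \<in> lf_measures. g M \<in> S}"
    by (auto simp: space_vague_borel)
  ultimately show "g -` S \<inter> space vague_borel \<in> sets vague_borel"
    by (auto simp: sets_vague_borel)
qed

lemma measurable_dilate:
  assumes "0 < c"
  shows "dilate c \<in> (vague_borel :: (real ^ 'n) measure measure) \<rightarrow>\<^sub>M vague_borel"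
proof (rule measurable_sigma_sets[OF sets_vague_borel])
  fix U :: "(real ^ 'n) measure set" assume "U \<in> {U. openin vague_topology U}"
  then have "openin vague_topology {M \<in> lf_measures. dilate c M \<in> U}"
    using openin_continuous_map_preimage[OF continuous_map_dilate[OF assms]]
    by (auto simp: topspace_vague_topology)
  moreover have "dilate c -` U \<inter> space vague_borel = {M \<in> lf_measures. dilate c M \<in> U}"
    by (auto simp: space_vague_borel)
  ultimately show "dilate c -` U \<inter> space vague_borel \<in> sets vague_borel"
    by (auto simp: sets_vague_borel)
qed (use assms openin_subset[of vague_topology] in
    \<open>auto simp: space_vague_borel topspace_vague_topology dilate_in_lf_measures\<close>)

lemma random_measure_in_lf: "random_measure P \<xi> \<Longrightarrow> \<omega> \<in> space P \<Longrightarrow> \<xi> \<omega> \<in> lf_measures"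
  unfolding random_measure_def using measurable_space[of \<xi> P vague_borel \<omega>]
  by (simp add: space_vague_borel)

lemma random_measure_dilate:
  "random_measure P \<xi> \<Longrightarrow> 0 < t \<Longrightarrow> random_measure P (\<lambda>\<omega>. dilate t (\<xi> \<omega>))"
  unfolding random_measure_def using measurable_compose[OF _ measurable_dilate] by blast

lemma integrable_bounded_continuous:
  assumes "random_measure P \<xi>" "continuous_map vague_topology euclideanreal g" "bounded (g ` lf_measures)"
  shows "integrable P (\<lambda>\<omega>. g (\<xi> \<omega>))"
proof -
  interpret prob_space P using assms(1) by (simp add: random_measure_def)
  obtain B where "\<forall>M\<in>lf_measures. \<bar>g M\<bar> \<le> B"
    using assms(3) unfolding bounded_iff by force
  moreover have "(\<lambda>\<omega>. g (\<xi> \<omega>)) \<in> borel_measurable P"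
    using assms(1) continuous_map_measurable_vague_borel[OF assms(2)]
    unfolding random_measure_def by (metis measurable_compose)
  ultimately show ?thesis
    using random_measure_in_lf[OF assms(1)] by (intro integrable_const_bound[of _ B] AE_I2) auto
qed

section \<open>Convergence along the reals\<close>

text \<open>
  Monotonicity and divergence of \<open>s\<close> place every large \<open>t\<close> between two successive terms with a
  large index, so what holds for large indices is available at every large real.
\<close>
lemma eventually_between_successive:
  fixes s :: "nat \<Rightarrow> real"
  assumes "incseq s" "filterlim s at_top sequentially" "eventually A sequentially"
  shows "eventually (\<lambda>t. \<exists>n. A n \<and> s n \<le> t \<and> t < s (Suc n)) at_top"
proof -
  obtain N where N: "\<And>n. n \<ge> N \<Longrightarrow> A n"
    using assms(3) by (auto simp: eventually_sequentially)
  have "\<exists>n. A n \<and> s n \<le> t \<and> t < s (Suc n)" if t: "s N \<le> t" for t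
  proof -
    have "eventually (\<lambda>n. t < s n) sequentially"
      using assms(2) by (simp add: filterlim_at_top_dense)
    then have ex: "\<exists>m. t < s m" by (auto simp: eventually_sequentially)
    define m where "m = (LEAST m. t < s m)"
    have m: "t < s m"
      unfolding m_def using ex by (rule LeastI_ex)
    have before: "s j \<le> t" if "j < m" for j
      using not_less_Least[OF that[unfolded m_def]] by simp
    have "N < m"
    proof (rule ccontr)
      assume "\<not> N < m"
      then have "s m \<le> s N" using assms(1) by (auto simp: incseq_def)
      then show False using m t by simp
    qed
    then have "A (m - 1)" "s (m - 1) \<le> t" "t < s (Suc (m - 1))"
      using m before[of "m - 1"] N[of "m - 1"] by auto
    then show ?thesis by blast
  qed
  then show ?thesis unfolding eventually_at_top_linorder by blast
qed

text \<open>
  The factors start at \<open>1\<close> because the scale \<open>s n\<close> chosen for \<open>t\<close> is the last one that does not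
  exceed \<open>t\<close>.
\<close>
definition sup_dilations :: "((real ^ 'n) measure \<Rightarrow> real) \<Rightarrow> real \<Rightarrow> (real ^ 'n) measure \<Rightarrow> real" where
  "sup_dilations g \<delta> M = (SUP c\<in>{1..1 + \<delta>}. g (dilate c M))"

lemma continuous_map_sup_dilations:
  fixes g :: "(real ^ 'n) measure \<Rightarrow> real"
  assumes g: "continuous_map vague_topology euclideanreal g" and "0 \<le> \<delta>"
  shows "continuous_map vague_topology euclideanreal (sup_dilations g \<delta>)"
  unfolding sup_dilations_def
proof (rule continuous_map_SUP_compact)
  let ?V = "vague_topology :: (real ^ 'n) measure topology"
  have "continuous_map (prod_topology (top_of_set {0<..}) ?V) euclideanreal (\<lambda>(c, M). g (dilate c M))"
    using continuous_map_compose[OF continuous_map_dilate_joint g] by (simp add: comp_def case_prod_unfold)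
  then have "continuous_map (subtopology (prod_topology euclideanreal ?V) ({0<..} \<times> UNIV)) euclideanreal (\<lambda>(c, M). g (dilate c M))"
    using subtopology_Times[of euclideanreal ?V "{0<..}" UNIV] by simp
  then have "continuous_map (subtopology (prod_topology euclideanreal ?V) ({1..1+\<delta>} \<times> UNIV)) euclideanreal (\<lambda>(c, M). g (dilate c M))"
    by (rule continuous_map_from_subtopology_mono) auto
  then show "continuous_map (prod_topology (top_of_set {1..1 + \<delta>}) ?V) euclideanreal (\<lambda>(c, M). g (dilate c M))"
    using subtopology_Times[of euclideanreal ?V "{1..1 + \<delta>}" UNIV] by simp
qed (use assms in auto)

lemma sup_dilations_upper:
  assumes "\<forall>M\<in>lf_measures. \<bar>g M\<bar> \<le> B" "M \<in> lf_measures" "c \<in> {1..1 + \<delta>}"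
  shows "g (dilate c M) \<le> sup_dilations g \<delta> M"
  unfolding sup_dilations_def
proof (rule cSUP_upper[OF assms(3)])
  have "g (dilate c M) \<le> B" if "c \<in> {1..1 + \<delta>}" for c
    using bspec[OF assms(1) dilate_in_lf_measures[of c M]] assms(2) that by (auto simp: abs_le_iff)
  then show "bdd_above ((\<lambda>c. g (dilate c M)) ` {1..1 + \<delta>})" by (intro bdd_aboveI2)
qed

lemma sup_dilations_bound:
  assumes B: "\<forall>M\<in>lf_measures. \<bar>g M\<bar> \<le> B" and "M \<in> lf_measures" "0 \<le> \<delta>"
  shows "\<bar>sup_dilations g \<delta> M\<bar> \<le> B"
proof -
  have "sup_dilations g \<delta> M \<le> B"
    unfolding sup_dilations_def
    using bspec[OF B dilate_in_lf_measures[of _ M]] assms(2,3) by (intro cSUP_least) (auto simp: abs_le_iff)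
  moreover have "- B \<le> sup_dilations g \<delta> M"
    using bspec[OF B assms(2)] sup_dilations_upper[OF B assms(2), where c = 1 and \<delta> = \<delta>] assms(2,3) by (auto simp: dilate_one abs_le_iff)
  ultimately show ?thesis by auto
qed

text \<open>
  The envelope lies above \<open>g M\<close> since \<open>c = 1\<close> is allowed, and close to it since
  \<open>c \<mapsto> g (dilate c M)\<close> is continuous at \<open>1\<close>.
\<close>
lemma sup_dilations_tendsto:
  fixes g :: "(real ^ 'n) measure \<Rightarrow> real"
  assumes g: "continuous_map vague_topology euclideanreal g"
    and B: "\<forall>M\<in>lf_measures. \<bar>g M\<bar> \<le> B" and M: "M \<in> lf_measures"
  shows "(\<lambda>n. sup_dilations g (1 / real (Suc n)) M) \<longlonglongrightarrow> g M"
proof (rule LIMSEQ_I)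
  fix e :: real assume e: "0 < e"
  have "continuous_map (top_of_set {0<..}) euclideanreal (g \<circ> ((\<lambda>(c, M). dilate c M) \<circ> (\<lambda>c. (c, M))))"
    using M by (intro continuous_map_compose[OF _ g] continuous_map_compose[OF _ continuous_map_dilate_joint] continuous_map_pairedI)
      (auto simp: continuous_map_id[unfolded id_def] topspace_vague_topology)
  then have "continuous_on {0<..} (\<lambda>c. g (dilate c M))" by (simp add: comp_def)
  then obtain d where d: "0 < d" "\<And>c. c \<in> {0<..} \<Longrightarrow> dist c 1 < d \<Longrightarrow> dist (g (dilate c M)) (g (dilate 1 M)) < e / 2"
    unfolding continuous_on_iff using e by (metis greaterThan_iff half_gt_zero zero_less_one)
  obtain N where N: "1 / real (Suc N) < d" using d(1) nat_approx_posE by blast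
  show "\<exists>n0. \<forall>n\<ge>n0. norm (sup_dilations g (1 / real (Suc n)) M - g M) < e"
  proof (intro exI[of _ N] allI impI)
    fix n assume "N \<le> n"
    then have "1 / real (Suc n) \<le> 1 / real (Suc N)" by (auto simp: field_simps)
    then have n: "1 / real (Suc n) < d" using N by simp
    have "g (dilate c M) \<le> g M + e / 2" if "c \<in> {1..1 + 1 / real (Suc n)}" for c
    proof -
      have "dist c 1 < d" using that n by (simp add: dist_real_def)
      then have "dist (g (dilate c M)) (g M) < e / 2" using d(2)[of c] that by (simp add: dilate_one[OF M])
      then show ?thesis unfolding dist_real_def by linarith
    qed
    then have "sup_dilations g (1 / real (Suc n)) M \<le> g M + e / 2"
      unfolding sup_dilations_def by (intro cSUP_least) auto
    moreover have "g M \<le> sup_dilations g (1 / real (Suc n)) M"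
      using sup_dilations_upper[OF B M, where c = 1 and \<delta> = "1 / real (Suc n)"] M by (simp add: dilate_one)
    ultimately show "norm (sup_dilations g (1 / real (Suc n)) M - g M) < e" using e by simp
  qed
qed

text \<open>
  The one-sided half of the convergence. The gap between \<open>a\<close> and the limiting expectation leaves
  room to replace \<open>g\<close> by an envelope with a fixed \<open>\<delta>\<close>; the envelope at scale \<open>s n\<close> dominates
  \<open>g\<close> at every scale \<open>t\<close> up to \<open>s (Suc n)\<close>.
\<close>
lemma eventually_expectation_dilate_less:
  fixes s :: "nat \<Rightarrow> real" and g :: "(real ^ 'n) measure \<Rightarrow> real"
  assumes s: "\<And>n. s n > 0" "incseq s" "filterlim s at_top sequentially" "(\<lambda>n. s n / s (Suc n)) \<longlonglongrightarrow> 1"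
    and \<nu>: "random_measure P \<nu>" and \<mu>: "random_measure Q \<mu>"
    and conv: "converges_in_distribution vague_topology P (\<lambda>n \<omega>. dilate (s n) (\<nu> \<omega>)) sequentially Q \<mu>"
    and g: "continuous_map vague_topology euclideanreal g" "bounded (g ` lf_measures)"
    and a: "(\<integral>\<omega>. g (\<mu> \<omega>) \<partial>Q) < a"
  shows "eventually (\<lambda>t. (\<integral>\<omega>. g (dilate t (\<nu> \<omega>)) \<partial>P) < a) at_top"
proof -
  interpret Q: prob_space Q using \<mu> by (simp add: random_measure_def)
  obtain B where B: "\<forall>M\<in>lf_measures. \<bar>g M\<bar> \<le> B"
    using g(2) unfolding bounded_iff by force
  have G_bdd: "bounded (sup_dilations g \<delta> ` lf_measures)" if "0 \<le> \<delta>" for \<delta>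
    unfolding bounded_iff using sup_dilations_bound[OF B _ that] by (intro exI[of _ B]) auto
  note G_cont = continuous_map_sup_dilations[OF g(1)]
  have "(\<lambda>n. \<integral>\<omega>. sup_dilations g (1 / real (Suc n)) (\<mu> \<omega>) \<partial>Q) \<longlonglongrightarrow> (\<integral>\<omega>. g (\<mu> \<omega>) \<partial>Q)"
  proof (rule integral_dominated_convergence[where w = "\<lambda>_. B"])
    show "(\<lambda>\<omega>. g (\<mu> \<omega>)) \<in> borel_measurable Q"
      using integrable_bounded_continuous[OF \<mu> g] by simp
    show "(\<lambda>\<omega>. sup_dilations g (1 / real (Suc n)) (\<mu> \<omega>)) \<in> borel_measurable Q" for n
      using integrable_bounded_continuous[OF \<mu> G_cont G_bdd, of "1 / real (Suc n)"] by simp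
    show "AE \<omega> in Q. (\<lambda>n. sup_dilations g (1 / real (Suc n)) (\<mu> \<omega>)) \<longlonglongrightarrow> g (\<mu> \<omega>)"
      using sup_dilations_tendsto[OF g(1) B] random_measure_in_lf[OF \<mu>] by (intro AE_I2) auto
    show "AE \<omega> in Q. norm (sup_dilations g (1 / real (Suc n)) (\<mu> \<omega>)) \<le> B" for n
      using sup_dilations_bound[OF B, where \<delta> = "1 / real (Suc n)"] random_measure_in_lf[OF \<mu>] by (intro AE_I2) auto
  qed simp
  from order_tendstoD(2)[OF this a]
  obtain j where j: "(\<integral>\<omega>. sup_dilations g (1 / real (Suc j)) (\<mu> \<omega>) \<partial>Q) < a"
    by (auto simp: eventually_sequentially)
  define \<delta> where "\<delta> = 1 / real (Suc j)"
  have \<delta>: "0 < \<delta>" by (simp add: \<delta>_def)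
  have "(\<lambda>n. \<integral>\<omega>. sup_dilations g \<delta> (dilate (s n) (\<nu> \<omega>)) \<partial>P) \<longlonglongrightarrow> (\<integral>\<omega>. sup_dilations g \<delta> (\<mu> \<omega>) \<partial>Q)"
    using conv G_cont[of \<delta>] G_bdd[of \<delta>] \<delta> unfolding converges_in_distribution_def topspace_vague_topology by auto
  from order_tendstoD(2)[OF this] j
  have ev1: "eventually (\<lambda>n. (\<integral>\<omega>. sup_dilations g \<delta> (dilate (s n) (\<nu> \<omega>)) \<partial>P) < a) sequentially"
    by (simp add: \<delta>_def)
  have "(\<lambda>n. inverse (s n / s (Suc n))) \<longlonglongrightarrow> inverse 1"
    using s(4) by (rule tendsto_inverse) simp
  then have "(\<lambda>n. s (Suc n) / s n) \<longlonglongrightarrow> 1" by simp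
  then have ev2: "eventually (\<lambda>n. s (Suc n) / s n < 1 + \<delta>) sequentially"
    using \<delta> by (intro order_tendstoD(2)) auto
  show ?thesis
  proof (rule eventually_mono[OF eventually_between_successive[OF s(2,3) eventually_conj[OF ev1 ev2]]])
    fix t assume "\<exists>n. ((\<integral>\<omega>. sup_dilations g \<delta> (dilate (s n) (\<nu> \<omega>)) \<partial>P) < a \<and> s (Suc n) / s n < 1 + \<delta>) \<and> s n \<le> t \<and> t < s (Suc n)"
    then obtain n where n: "(\<integral>\<omega>. sup_dilations g \<delta> (dilate (s n) (\<nu> \<omega>)) \<partial>P) < a"
      "s (Suc n) / s n < 1 + \<delta>" "s n \<le> t" "t < s (Suc n)" by blast
    have sn: "0 < s n" using s(1) .
    have t: "0 < t" using sn n(3) by simp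
    have "t / s n \<le> s (Suc n) / s n" using n(4) sn by (intro divide_right_mono) auto
    then have c: "t / s n \<in> {1..1 + \<delta>}" using n sn by (auto simp: field_simps)
    have "(\<integral>\<omega>. g (dilate t (\<nu> \<omega>)) \<partial>P) \<le> (\<integral>\<omega>. sup_dilations g \<delta> (dilate (s n) (\<nu> \<omega>)) \<partial>P)"
    proof (rule integral_mono)
      show "integrable P (\<lambda>\<omega>. g (dilate t (\<nu> \<omega>)))"
        using random_measure_dilate[OF \<nu> t] g by (rule integrable_bounded_continuous)
      show "integrable P (\<lambda>\<omega>. sup_dilations g \<delta> (dilate (s n) (\<nu> \<omega>)))"
        using \<delta> by (intro integrable_bounded_continuous random_measure_dilate \<nu> sn G_cont G_bdd) auto
      fix \<omega> assume "\<omega> \<in> space P"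
      then have M: "\<nu> \<omega> \<in> lf_measures" by (rule random_measure_in_lf[OF \<nu>])
      have "dilate t (\<nu> \<omega>) = dilate (t / s n) (dilate (s n) (\<nu> \<omega>))"
        using t sn M by (simp add: dilate_dilate)
      then show "g (dilate t (\<nu> \<omega>)) \<le> sup_dilations g \<delta> (dilate (s n) (\<nu> \<omega>))"
        using sup_dilations_upper[OF B dilate_in_lf_measures[OF sn M] c] by simp
    qed
    then show "(\<integral>\<omega>. g (dilate t (\<nu> \<omega>)) \<partial>P) < a" using n(1) by simp
  qed
qed

lemma converges_in_distribution_along_reals:
  fixes s :: "nat \<Rightarrow> real" and \<nu> :: "'p \<Rightarrow> (real ^ 'n) measure"
  assumes s: "\<And>n. s n > 0" "incseq s" "filterlim s at_top sequentially" "(\<lambda>n. s n / s (Suc n)) \<longlonglongrightarrow> 1"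
    and \<nu>: "random_measure P \<nu>" and \<mu>: "random_measure Q \<mu>"
    and conv: "converges_in_distribution vague_topology P (\<lambda>n \<omega>. dilate (s n) (\<nu> \<omega>)) sequentially Q \<mu>"
  shows "converges_in_distribution vague_topology P (\<lambda>t \<omega>. dilate t (\<nu> \<omega>)) at_top Q \<mu>"
  unfolding converges_in_distribution_def topspace_vague_topology
proof (intro allI impI order_tendstoI)
  fix g :: "(real ^ 'n) measure \<Rightarrow> real" and a
  assume g: "continuous_map vague_topology euclideanreal g \<and> bounded (g ` lf_measures)"
  note less = eventually_expectation_dilate_less[OF s \<nu> \<mu> conv]
  {
    assume "(\<integral>\<omega>. g (\<mu> \<omega>) \<partial>Q) < a"
    then show "eventually (\<lambda>t. (\<integral>\<omega>. g (dilate t (\<nu> \<omega>)) \<partial>P) < a) at_top"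
      using less g by blast
  next
    assume a: "a < (\<integral>\<omega>. g (\<mu> \<omega>) \<partial>Q)"
    have "continuous_map vague_topology euclideanreal (\<lambda>M. - g M)" "bounded ((\<lambda>M. - g M) ` lf_measures)"
      using g by (auto simp: bounded_iff intro: continuous_map_minus)
    from less[OF this, of "- a"] a
    show "eventually (\<lambda>t. a < (\<integral>\<omega>. g (dilate t (\<nu> \<omega>)) \<partial>P)) at_top" by simp
  }
qed

section \<open>Cozero sets\<close>

text \<open>
  The indicator of a cozero set is the increasing limit of the bounded continuous functions
  \<open>min 1 (n * \<bar>g\<bar>)\<close>, so expectations of continuous functions determine its probability.
\<close>
definition cozero_in :: "'a topology \<Rightarrow> 'a set \<Rightarrow> bool" where
  "cozero_in X A \<longleftrightarrow> (\<exists>g. continuous_map X euclideanreal g \<and> A = {x \<in> topspace X. g x \<noteq> 0})"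

lemma openin_cozero:
  assumes "cozero_in X A"
  shows "openin X A"
proof -
  obtain g where g: "continuous_map X euclideanreal g" "A = {x \<in> topspace X. g x \<noteq> 0}"
    using assms unfolding cozero_in_def by blast
  have "openin X {x \<in> topspace X. g x \<in> - {0}}"
    by (rule openin_continuous_map_preimage[OF g(1)]) auto
  then show ?thesis by (simp add: g(2))
qed

lemma cozero_in_topspace: "cozero_in X (topspace X)"
  unfolding cozero_in_def by (intro exI[of _ "\<lambda>_. 1"]) auto

lemma cozero_in_Int:
  assumes "cozero_in X A" "cozero_in X B"
  shows "cozero_in X (A \<inter> B)"
proof -
  obtain g h where "continuous_map X euclideanreal g" "A = {x \<in> topspace X. g x \<noteq> 0}"
    "continuous_map X euclideanreal h" "B = {x \<in> topspace X. h x \<noteq> 0}"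
    using assms unfolding cozero_in_def by blast
  then show ?thesis
    unfolding cozero_in_def by (intro exI[of _ "\<lambda>x. g x * h x"]) (auto intro: continuous_map_real_mult)
qed

lemma cozero_in_finite_Inter:
  assumes "finite F" "\<And>A. A \<in> F \<Longrightarrow> cozero_in X A"
  shows "cozero_in X (topspace X \<inter> \<Inter>F)"
  using assms
proof (induction F rule: finite_induct)
  case (insert A F)
  then have "cozero_in X (A \<inter> (topspace X \<inter> \<Inter>F))" by (intro cozero_in_Int[of X A]) auto
  moreover have "A \<inter> (topspace X \<inter> \<Inter>F) = topspace X \<inter> \<Inter>(insert A F)" by auto
  ultimately show ?case by simp
qed (simp add: cozero_in_topspace)

lemma cozero_in_greater:
  assumes "continuous_map X euclideanreal g"
  shows "cozero_in X {x \<in> topspace X. a < g x}"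
  unfolding cozero_in_def
  using assms by (intro exI[of _ "\<lambda>x. max 0 (g x - a)"])
    (auto intro!: continuous_map_real_max continuous_map_diff)

lemma cozero_in_less:
  assumes "continuous_map X euclideanreal g"
  shows "cozero_in X {x \<in> topspace X. g x < a}"
  using cozero_in_greater[OF continuous_map_minus[OF assms], of "- a"] by simp

section \<open>A countable subbase of the vague topology\<close>

text \<open>
  Apex, height and slope of a cone. The heights and slopes are taken from countable types; a
  countable dense set of apexes then gives countably many cones.
\<close>
type_synonym 'n tent_param = "(real ^ 'n) \<times> rat \<times> nat"

definition tent :: "'n tent_param \<Rightarrow> real ^ 'n \<Rightarrow> real" where
  "tent p x = (case p of (y, q, L) \<Rightarrow> real_of_rat q - real L * dist x y)"

primrec tent_max :: "'n tent_param list \<Rightarrow> real ^ 'n \<Rightarrow> real" where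
  "tent_max [] x = 0"
| "tent_max (p # ps) x = max (tent p x) (tent_max ps x)"

lemma tent_max_nonneg: "0 \<le> tent_max ps x"
  by (induction ps) (auto simp: le_max_iff_disj)

lemma tent_le_tent_max: "p \<in> set ps \<Longrightarrow> tent p x \<le> tent_max ps x"
  by (induction ps) (auto simp: le_max_iff_disj)

lemma tent_max_le: "0 \<le> b \<Longrightarrow> (\<And>p. p \<in> set ps \<Longrightarrow> tent p x \<le> b) \<Longrightarrow> tent_max ps x \<le> b"
  by (induction ps) auto

lemma continuous_on_tent_max: "continuous_on A (tent_max ps)"
proof (induction ps)
  case (Cons p ps)
  have "continuous_on A (tent p)"
    unfolding tent_def by (cases p) (auto intro!: continuous_intros)
  then show ?case using Cons by (auto intro: continuous_on_max)
qed simp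

lemma vague_test_fun_below:
  fixes f h :: "real ^ 'n \<Rightarrow> real"
  assumes f: "vague_test_fun f" and h: "continuous_on punctured h"
    and le: "\<And>x. x \<in> punctured \<Longrightarrow> 0 \<le> h x \<and> h x \<le> f x"
  shows "vague_test_fun h"
  unfolding vague_test_fun_def
proof (intro conjI h)
  obtain B where "\<forall>x\<in>punctured. \<bar>f x\<bar> \<le> B"
    using f unfolding vague_test_fun_def bounded_iff by force
  then have "\<bar>h x\<bar> \<le> B" if "x \<in> punctured" for x
    using le[OF that] that by (metis abs_of_nonneg order_trans)
  then show "bounded (h ` punctured)" unfolding bounded_iff by auto
  have "{x \<in> punctured. h x \<noteq> 0} \<subseteq> {x \<in> punctured. f x \<noteq> 0}" using le by force
  moreover have "rel_compact {x \<in> punctured. f x \<noteq> 0}" using f by (simp add: vague_test_fun_def)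
  ultimately show "rel_compact {x \<in> punctured. h x \<noteq> 0}"
    unfolding rel_compact_def by (meson bounded_subset order_trans subset_iff)
qed (use le in auto)

text \<open>
  Choose a height \<open>q\<close> slightly below \<open>f x\<close>; by continuity \<open>f\<close> exceeds \<open>q\<close> on a ball around \<open>x\<close>.
  A cone of height \<open>q\<close> that is steep enough is negative outside this ball, and if its apex is
  close enough to \<open>x\<close> its value at \<open>x\<close> is still almost \<open>q\<close>.
\<close>
lemma exists_tent_below:
  fixes f :: "real ^ 'n \<Rightarrow> real" and D :: "(real ^ 'n) set"
  assumes f: "vague_test_fun f" and x: "x \<in> punctured" and e: "0 < e"
    and D: "\<And>X. open X \<Longrightarrow> X \<noteq> {} \<Longrightarrow> \<exists>d\<in>D. d \<in> X"
  shows "\<exists>p\<in>D \<times> UNIV. (\<forall>y\<in>punctured. tent p y \<le> f y) \<and> f x - e < tent p x"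
proof -
  have f0: "\<And>y. y \<in> punctured \<Longrightarrow> 0 \<le> f y" using f by (simp add: vague_test_fun_def)
  show ?thesis
  proof (cases "f x - e < 0")
    case True
    obtain d where "d \<in> D" using D[of UNIV] by auto
    then show ?thesis using True f0 by (intro bexI[of _ "(d, 0, 0)"]) (auto simp: tent_def)
  next
    case False
    obtain q where q: "f x - e < real_of_rat q" "real_of_rat q < f x"
      using of_rat_dense[of "f x - e" "f x"] e by auto
    let ?q = "real_of_rat q"
    have "open (punctured \<inter> f -` {?q<..})"
      using vague_test_fun_continuous_on[OF f] by (rule continuous_open_preimage) auto
    moreover have "x \<in> punctured \<inter> f -` {?q<..}" using x q(2) by auto
    ultimately obtain r where r: "0 < r" "\<And>y. dist y x < r \<Longrightarrow> y \<in> punctured \<inter> f -` {?q<..}"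
      unfolding open_dist by blast
    \<comment> \<open>The cone drops below \<open>0\<close> at distance \<open>r / 2\<close> from its apex.\<close>
    obtain L :: nat where L: "2 * ?q / r < real L" using reals_Archimedean2 by blast
    have Lpos: "0 < real L" using L q False r(1) by (smt (verit) divide_nonneg_pos)
    let ?\<rho> = "min (r / 2) ((?q - (f x - e)) / real L)"
    have "0 < ?\<rho>" using r(1) q(1) Lpos by simp
    then have "ball x ?\<rho> \<noteq> {}" by (metis centre_in_ball empty_iff)
    then obtain d where d: "d \<in> D" "d \<in> ball x ?\<rho>" using D[OF open_ball] by blast
    have "real L * dist x d < ?q - (f x - e)" using d(2) Lpos by (simp add: pos_less_divide_eq mult.commute)
    moreover have "tent (d, q, L) y \<le> f y" if y: "y \<in> punctured" for y
    proof (cases "dist y d < r / 2")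
      case True
      then have "dist y x < r" using d(2) dist_triangle[of y x d] by (simp add: dist_commute)
      then have "?q < f y" using r(2) by auto
      moreover have "0 \<le> real L * dist y d" by simp
      ultimately have "?q - real L * dist y d \<le> f y" by linarith
      then show ?thesis by (simp add: tent_def)
    next
      case False
      then have "real L * (r / 2) \<le> real L * dist y d" by (intro mult_left_mono) auto
      moreover have "?q < real L * (r / 2)" using L r(1) by (simp add: field_simps)
      ultimately show ?thesis using f0[OF y] by (simp add: tent_def)
    qed
    ultimately show ?thesis using d(1) by (intro bexI[of _ "(d, q, L)"]) (auto simp: tent_def)
  qed
qed

text \<open>
  The finite maxima of an enumeration of the cones below \<open>f\<close> converge pointwise to \<open>f\<close> and are
  dominated by it, so their integrals converge. Being squeezed between \<open>0\<close> and \<open>f\<close>, they are test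
  functions, although cones from the same countable family need not be.
\<close>
lemma exists_tent_max_integral_greater:
  fixes f :: "real ^ 'n \<Rightarrow> real" and D :: "(real ^ 'n) set"
  assumes f: "vague_test_fun f" and M: "M \<in> lf_measures" and a: "a < (\<integral>x. f x \<partial>M)"
    and D: "countable D" "\<And>X. open X \<Longrightarrow> X \<noteq> {} \<Longrightarrow> \<exists>d\<in>D. d \<in> X"
  shows "\<exists>ps\<in>lists (D \<times> UNIV). vague_test_fun (tent_max ps) \<and>
    (\<forall>x\<in>punctured. tent_max ps x \<le> f x) \<and> a < (\<integral>x. tent_max ps x \<partial>M)"
proof -
  define J where "J = {p \<in> D \<times> UNIV. \<forall>y\<in>punctured. tent p y \<le> f y}"
  have f0: "\<And>y. y \<in> punctured \<Longrightarrow> 0 \<le> f y" using f by (simp add: vague_test_fun_def)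
  have J: "countable J" "J \<noteq> {}"
  proof -
    show "countable J" unfolding J_def using D(1) by (intro countable_Collect countable_SIGMA) auto
    \<comment> \<open>The zero cone is always available, so the enumeration of \<open>J\<close> makes sense.\<close>
    obtain d where "d \<in> D" using D(2)[of UNIV] by auto
    then have "(d, 0, 0) \<in> J" using f0 by (auto simp: J_def tent_def)
    then show "J \<noteq> {}" by blast
  qed
  define P where "P n = map (from_nat_into J) [0..<n]" for n
  have P: "set (P n) \<subseteq> J" for n using from_nat_into[OF J(2)] by (auto simp: P_def)
  have le: "tent_max (P n) x \<le> f x" if "x \<in> punctured" for n x
    using P[of n] that f0 by (intro tent_max_le) (auto simp: J_def)
  have test: "vague_test_fun (tent_max (P n))" for n
    using f continuous_on_tent_max by (rule vague_test_fun_below) (auto simp: tent_max_nonneg le)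
  have lim: "(\<lambda>n. tent_max (P n) x) \<longlonglongrightarrow> f x" if x: "x \<in> punctured" for x
  proof (rule LIMSEQ_I)
    fix e :: real assume "0 < e"
    then obtain p where p: "p \<in> J" "f x - e < tent p x"
      using exists_tent_below[OF f x _ D(2)] unfolding J_def by blast
    obtain i where i: "p = from_nat_into J i" using from_nat_into_surj[OF J(1) p(1)] by metis
    have "norm (tent_max (P n) x - f x) < e" if "Suc i \<le> n" for n
    proof -
      have "p \<in> set (P n)" using that by (auto simp: P_def i)
      then have "tent p x \<le> tent_max (P n) x" by (rule tent_le_tent_max)
      then show ?thesis using p(2) le[OF x, of n] by simp
    qed
    then show "\<exists>n0. \<forall>n\<ge>n0. norm (tent_max (P n) x - f x) < e" by blast
  qed
  have "(\<lambda>n. \<integral>x. tent_max (P n) x \<partial>M) \<longlonglongrightarrow> (\<integral>x. f x \<partial>M)"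
    using vague_test_fun_integrable[OF f M] vague_test_fun_integrable[OF test M] lim le
    by (intro integral_dominated_convergence[where w = f] AE_I2)
      (auto simp: lf_measures_space[OF M] tent_max_nonneg)
  from order_tendstoD(1)[OF this a] obtain n where "a < (\<integral>x. tent_max (P n) x \<partial>M)"
    by (auto simp: eventually_sequentially)
  moreover have "P n \<in> lists (D \<times> UNIV)" using P[of n] by (auto simp: J_def in_lists_conv_set)
  ultimately show ?thesis using test le by blast
qed

text \<open>
  Writing \<open>f\<close> as a multiple of a cutoff minus another test function turns upper bounds for the
  integral of \<open>f\<close> into an upper bound for the cutoff and a lower bound for a test function.
\<close>
lemma exists_cutoff_dominating:
  fixes f :: "real ^ 'n \<Rightarrow> real"
  assumes f: "vague_test_fun f"
  obtains k C where "0 < k" "0 \<le> C" "vague_test_fun (\<lambda>x. C * annulus_cutoff k x - f x)"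
proof -
  obtain r R where rR: "0 < r" "0 < R" "\<forall>x\<in>punctured. f x \<noteq> 0 \<longrightarrow> r \<le> norm x \<and> norm x \<le> R"
    using vague_test_fun_in_annulus[OF f] by metis
  obtain k :: nat where k: "0 < k" "1 / real k \<le> r" "R \<le> real k"
    using exists_annulus_index[OF rR(1), of R] by metis
  obtain B where "\<forall>x\<in>punctured. \<bar>f x\<bar> \<le> B"
    using f unfolding vague_test_fun_def bounded_iff by force
  then have B: "\<forall>x\<in>punctured. f x \<le> max 0 B" by (auto simp: le_max_iff_disj abs_le_iff)
  let ?C = "max 0 B" and ?\<phi> = "annulus_cutoff k :: real ^ 'n \<Rightarrow> real"
  have \<phi>: "vague_test_fun ?\<phi>" using k(1) by (rule vague_test_fun_annulus_cutoff)
  have f0: "\<forall>y\<in>punctured. 0 \<le> f y" using f by (simp add: vague_test_fun_def)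
  have le: "f x \<le> ?C * ?\<phi> x" if x: "x \<in> punctured" for x
  proof (cases "f x = 0")
    case False
    then have "r \<le> norm x \<and> norm x \<le> R" using rR(3) x by blast
    then have "?\<phi> x = 1" using k by (intro annulus_cutoff_eq_1) linarith+
    then show ?thesis using B x by simp
  qed (simp add: annulus_cutoff_bounds)
  have "vague_test_fun (\<lambda>x. ?C * ?\<phi> x)"
    unfolding vague_test_fun_def
  proof (intro conjI)
    show "continuous_on punctured (\<lambda>x. ?C * ?\<phi> x)"
      by (intro continuous_on_mult continuous_on_const vague_test_fun_continuous_on \<phi>)
    have "\<bar>?C * ?\<phi> x\<bar> \<le> ?C * 1" for x
      using annulus_cutoff_bounds[of k x] by (simp add: abs_mult mult_left_le)
    then show "bounded ((\<lambda>x. ?C * ?\<phi> x) ` punctured)" unfolding bounded_iff by auto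
    have "{x \<in> punctured. ?C * ?\<phi> x \<noteq> 0} \<subseteq> {x \<in> punctured. ?\<phi> x \<noteq> 0}" by auto
    moreover have "rel_compact {x \<in> punctured. ?\<phi> x \<noteq> 0}" using \<phi> by (simp add: vague_test_fun_def)
    ultimately show "rel_compact {x \<in> punctured. ?C * ?\<phi> x \<noteq> 0}"
      unfolding rel_compact_def by (meson bounded_subset order_trans subset_iff)
  qed (simp add: annulus_cutoff_bounds)
  then have "vague_test_fun (\<lambda>x. ?C * ?\<phi> x - f x)"
  proof (rule vague_test_fun_below)
    show "continuous_on punctured (\<lambda>x. ?C * ?\<phi> x - f x)"
      by (intro continuous_on_diff continuous_on_mult continuous_on_const vague_test_fun_continuous_on \<phi> f)
  qed (use le f0 in auto)
  then show ?thesis using k(1) by (intro that[of k ?C]) auto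
qed

text \<open>
  The subbase consists of rational lower bounds for the integrals of finite maxima of cones and
  rational upper bounds for the integrals of cutoffs. Lower bounds for a general test function
  follow by approximation from below, upper bounds by passing to the complement under a multiple of
  a cutoff; together they give all intervals and hence all subbasic sets of the vague topology.
\<close>
lemma vague_countable_cozero_subbase:
  obtains S :: "(real ^ 'n) measure set set"
  where "countable S" "\<And>A. A \<in> S \<Longrightarrow> cozero_in vague_topology A"
    "\<And>U M. openin vague_topology U \<Longrightarrow> M \<in> U \<Longrightarrow>
      \<exists>F. finite F \<and> F \<subseteq> S \<and> M \<in> lf_measures \<inter> \<Inter>F \<and> lf_measures \<inter> \<Inter>F \<subseteq> U"
proof -
  obtain D :: "(real ^ 'n) set" where D: "countable D" "\<And>X. open X \<Longrightarrow> X \<noteq> {} \<Longrightarrow> \<exists>d\<in>D. d \<in> X"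
    using countable_dense_setE by (metis (no_types, lifting))
  define lower where "lower = (\<lambda>(ps, q). {M \<in> lf_measures. real_of_rat q < (\<integral>x. tent_max ps x \<partial>M)}) `
    ({ps \<in> lists (D \<times> UNIV). vague_test_fun (tent_max ps)} \<times> UNIV)"
  define upper where "upper = (\<lambda>(k, q). {M \<in> (lf_measures :: (real ^ 'n) measure set).
    (\<integral>x. annulus_cutoff k x \<partial>M) < real_of_rat q}) ` ({0<..} \<times> UNIV)"
  have lowerI: "{M \<in> lf_measures. real_of_rat q < (\<integral>x. tent_max ps x \<partial>M)} \<in> lower"
    if "ps \<in> lists (D \<times> UNIV)" "vague_test_fun (tent_max ps)" for ps q
    using that unfolding lower_def by blast
  have upperI: "{M \<in> lf_measures. (\<integral>x. annulus_cutoff k x \<partial>M) < real_of_rat q} \<in> upper"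
    if "0 < k" for k q
    using that unfolding upper_def by blast
  define nb where "nb U M \<longleftrightarrow> (\<exists>F. finite F \<and> F \<subseteq> lower \<union> upper \<and> M \<in> lf_measures \<inter> \<Inter>F \<and> lf_measures \<inter> \<Inter>F \<subseteq> U)" for U M
  have nbhd_greater: "nb {M \<in> lf_measures. a < (\<integral>x. f x \<partial>M)} M"
    if f: "vague_test_fun f" and M: "M \<in> lf_measures" and a: "a < (\<integral>x. f x \<partial>M)" for f a M
  proof -
    obtain ps where ps: "ps \<in> lists (D \<times> UNIV)" "vague_test_fun (tent_max ps)"
      "\<forall>x\<in>punctured. tent_max ps x \<le> f x" "a < (\<integral>x. tent_max ps x \<partial>M)"
      using exists_tent_max_integral_greater[OF f M a D] by blast
    obtain q where q: "a < real_of_rat q" "real_of_rat q < (\<integral>x. tent_max ps x \<partial>M)"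
      using of_rat_dense[OF ps(4)] by blast
    let ?A = "{M \<in> lf_measures. real_of_rat q < (\<integral>x. tent_max ps x \<partial>M)}"
    have "a < (\<integral>x. f x \<partial>N)" if "N \<in> ?A" for N
      using that q(1) vague_integral_mono[OF ps(2) f, of N] ps(3) by force
    then have "lf_measures \<inter> \<Inter>{?A} \<subseteq> {M \<in> lf_measures. a < (\<integral>x. f x \<partial>M)}" by blast
    then show ?thesis using lowerI[OF ps(1,2), of q] M q(2) unfolding nb_def by (intro exI[of _ "{?A}"]) simp
  qed
  have nbhd_Int: "nb (U \<inter> V) M" if U: "nb U M" and V: "nb V M" for U V M
  proof -
    obtain F G where "finite F \<and> F \<subseteq> lower \<union> upper \<and> M \<in> lf_measures \<inter> \<Inter>F \<and> lf_measures \<inter> \<Inter>F \<subseteq> U"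
      "finite G \<and> G \<subseteq> lower \<union> upper \<and> M \<in> lf_measures \<inter> \<Inter>G \<and> lf_measures \<inter> \<Inter>G \<subseteq> V"
      using U V unfolding nb_def by blast
    then show ?thesis unfolding nb_def by (intro exI[of _ "F \<union> G"]) auto
  qed
  have nbhd_mono: "nb V M" if "nb U M" "U \<subseteq> V" for U V M
    using that unfolding nb_def by (meson order_trans)
  have nbhd_less: "nb {M \<in> lf_measures. (\<integral>x. f x \<partial>M) < b} M"
    if f: "vague_test_fun f" and M: "M \<in> lf_measures" and b: "(\<integral>x. f x \<partial>M) < b" for f b M
  proof -
    obtain k C where k: "0 < k" and C: "0 \<le> C" and g: "vague_test_fun (\<lambda>x. C * annulus_cutoff k x - f x)"
      using exists_cutoff_dominating[OF f] by metis
    let ?\<phi> = "annulus_cutoff k :: real ^ 'n \<Rightarrow> real"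
    have \<phi>: "vague_test_fun ?\<phi>" using k by (rule vague_test_fun_annulus_cutoff)
    have eq: "(\<integral>x. C * ?\<phi> x - f x \<partial>N) = C * (\<integral>x. ?\<phi> x \<partial>N) - (\<integral>x. f x \<partial>N)" if "N \<in> lf_measures" for N
      using vague_test_fun_integrable[OF \<phi> that] vague_test_fun_integrable[OF f that] by simp
    \<comment> \<open>Dividing by \<open>C + 1\<close> instead of \<open>C\<close> covers \<open>C = 0\<close> and gives a strict inequality below.\<close>
    define \<eta> where "\<eta> = (b - (\<integral>x. f x \<partial>M)) / (C + 1)"
    have \<eta>: "0 < \<eta>" "(C + 1) * \<eta> = b - (\<integral>x. f x \<partial>M)" using b C by (auto simp: \<eta>_def)
    obtain p where p: "(\<integral>x. ?\<phi> x \<partial>M) < real_of_rat p" "real_of_rat p < (\<integral>x. ?\<phi> x \<partial>M) + \<eta>"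
      using of_rat_dense[of "\<integral>x. ?\<phi> x \<partial>M" "(\<integral>x. ?\<phi> x \<partial>M) + \<eta>"] \<eta>(1) by auto
    let ?A = "{N \<in> lf_measures. (\<integral>x. ?\<phi> x \<partial>N) < real_of_rat p}"
    let ?B = "{N \<in> lf_measures. C * real_of_rat p - b < (\<integral>x. C * ?\<phi> x - f x \<partial>N)}"
    have "C * real_of_rat p \<le> C * ((\<integral>x. ?\<phi> x \<partial>M) + \<eta>)" using p(2) C by (intro mult_left_mono) auto
    also have "\<dots> = C * (\<integral>x. ?\<phi> x \<partial>M) + (b - (\<integral>x. f x \<partial>M)) - \<eta>"
      using \<eta>(2) by (simp add: algebra_simps)
    finally have "C * real_of_rat p - b < (\<integral>x. C * ?\<phi> x - f x \<partial>M)"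
      using \<eta>(1) eq[OF M] by linarith
    then have B: "nb ?B M" by (rule nbhd_greater[OF g M])
    have A: "nb ?A M" using upperI[OF k, of p] M p(1) unfolding nb_def by (intro exI[of _ "{?A}"]) simp
    have "?A \<inter> ?B \<subseteq> {M \<in> lf_measures. (\<integral>x. f x \<partial>M) < b}"
    proof clarify
      fix N assume N: "N \<in> lf_measures" "(\<integral>x. ?\<phi> x \<partial>N) < real_of_rat p"
        "C * real_of_rat p - b < (\<integral>x. C * ?\<phi> x - f x \<partial>N)"
      have "C * (\<integral>x. ?\<phi> x \<partial>N) \<le> C * real_of_rat p" using N(2) C by (intro mult_left_mono) auto
      then show "(\<integral>x. f x \<partial>N) < b" using N(3) eq[OF N(1)] by linarith
    qed
    then show ?thesis by (rule nbhd_mono[OF nbhd_Int[OF A B]])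
  qed
  have nbhd: "nb U M" if "openin vague_topology U" "M \<in> U" for U M
  proof -
    have "generate_topology_on {{M\<in>lf_measures. (\<integral>x. f x \<partial>M) \<in> U} | f U. vague_test_fun f \<and> open U} U"
      using that(1) unfolding vague_topology_def by (rule openin_topology_generated_by)
    then show ?thesis using that(2)
    proof (induction arbitrary: M)
      case (Int U V) then show ?case by (intro nbhd_Int) auto
    next
      case (UN K)
      then obtain U where "U \<in> K" "M \<in> U" by blast
      then have "nb U M" using UN.IH by blast
      then show ?case using \<open>U \<in> K\<close> by (intro nbhd_mono[of U M "\<Union>K"]) auto
    next
      case (Basis W)
      then obtain f V where W: "W = {M\<in>lf_measures. (\<integral>x. f x \<partial>M) \<in> V}" "vague_test_fun f" "open V"
        by blast
      have M: "M \<in> lf_measures" "(\<integral>x. f x \<partial>M) \<in> V" using Basis.prems W(1) by auto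
      obtain e where e: "0 < e" "\<And>y. dist y (\<integral>x. f x \<partial>M) < e \<Longrightarrow> y \<in> V"
        using W(3) M(2) unfolding open_dist by blast
      let ?c = "\<integral>x. f x \<partial>M"
      have "nb ({M \<in> lf_measures. ?c - e < (\<integral>x. f x \<partial>M)} \<inter> {M \<in> lf_measures. (\<integral>x. f x \<partial>M) < ?c + e}) M"
        using e(1) by (intro nbhd_Int nbhd_greater nbhd_less W(2) M(1)) auto
      then show ?case
        by (rule nbhd_mono) (auto simp: W(1) dist_real_def abs_less_iff intro!: e(2))
    qed simp
  qed
  have "countable (lower \<union> upper)"
    unfolding lower_def upper_def
    using D(1) by (intro countable_Un countable_image countable_SIGMA countable_Collect countable_lists) auto
  moreover have "cozero_in vague_topology A" if "A \<in> lower \<union> upper" for A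
    using that cozero_in_greater[OF continuous_map_vague_integral] cozero_in_less[OF continuous_map_vague_integral[OF vague_test_fun_annulus_cutoff]]
    unfolding lower_def upper_def topspace_vague_topology by auto
  ultimately show ?thesis using nbhd unfolding nb_def by (intro that[of "lower \<union> upper"]) auto
qed

section \<open>Laws are determined by continuous functions\<close>

text \<open>
  Only countably many finite intersections can be formed from a countable subbase, so an arbitrary
  union of them, i.e. an arbitrary open set, is a countable union of cozero sets.
\<close>
lemma sets_vague_borel_cozero:
  "sets (vague_borel :: (real ^ 'n) measure measure) = sigma_sets lf_measures {A. cozero_in vague_topology A}"
proof -
  have "sigma_sets lf_measures {A. cozero_in vague_topology A}
      \<subseteq> sigma_sets lf_measures {U :: (real ^ 'n) measure set. openin vague_topology U}"
    by (intro sigma_sets_mono') (auto intro: openin_cozero)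
  moreover have "U \<in> sigma_sets lf_measures {A. cozero_in vague_topology A}"
    if U: "openin vague_topology U" for U :: "(real ^ 'n) measure set"
  proof -
    obtain S :: "(real ^ 'n) measure set set" where S: "countable S" "\<And>A. A \<in> S \<Longrightarrow> cozero_in vague_topology A"
      "\<And>U M. openin vague_topology U \<Longrightarrow> M \<in> U \<Longrightarrow>
        \<exists>F. finite F \<and> F \<subseteq> S \<and> M \<in> lf_measures \<inter> \<Inter>F \<and> lf_measures \<inter> \<Inter>F \<subseteq> U"
      using vague_countable_cozero_subbase by blast
    define \<F> where "\<F> = {F. finite F \<and> F \<subseteq> S \<and> lf_measures \<inter> \<Inter>F \<subseteq> U}"
    have "countable {F. finite F \<and> F \<subseteq> S}" using S(1) by (rule countable_Collect_finite_subset)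
    then have "countable \<F>" by (rule countable_subset[rotated]) (auto simp: \<F>_def)
    moreover have "lf_measures \<inter> \<Inter>F \<in> sigma_sets lf_measures {A. cozero_in vague_topology A}" if "F \<in> \<F>" for F
      using that S(2) cozero_in_finite_Inter[of F vague_topology]
      by (intro sigma_sets.Basic) (auto simp: \<F>_def topspace_vague_topology)
    ultimately have "(\<Union>F\<in>\<F>. lf_measures \<inter> \<Inter>F) \<in> sigma_sets lf_measures {A. cozero_in vague_topology A}"
      by (intro sigma_sets_UNION) auto
    moreover have "U = (\<Union>F\<in>\<F>. lf_measures \<inter> \<Inter>F)"
    proof (intro equalityI subsetI)
      fix M assume "M \<in> U"
      then obtain F where "F \<in> \<F>" "M \<in> lf_measures \<inter> \<Inter>F"
        using S(3)[OF U, of M] unfolding \<F>_def by auto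
      then show "M \<in> (\<Union>F\<in>\<F>. lf_measures \<inter> \<Inter>F)" by blast
    qed (auto simp: \<F>_def)
    ultimately show ?thesis by simp
  qed
  then have "sigma_sets lf_measures {U :: (real ^ 'n) measure set. openin vague_topology U}
      \<subseteq> sigma_sets lf_measures {A. cozero_in vague_topology A}"
    by (intro sigma_sets_mono) auto
  ultimately show ?thesis unfolding sets_vague_borel by blast
qed

lemma expectation_tendsto_cozero:
  fixes g :: "(real ^ 'n) measure \<Rightarrow> real"
  assumes \<xi>: "random_measure P \<xi>" and g: "continuous_map vague_topology euclideanreal g"
  shows "(\<lambda>n. \<integral>\<omega>. min 1 (real n * \<bar>g (\<xi> \<omega>)\<bar>) \<partial>P) \<longlonglongrightarrow>
    measure (distr P vague_borel \<xi>) {M \<in> lf_measures. g M \<noteq> 0}"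
proof -
  interpret prob_space P using \<xi> by (simp add: random_measure_def)
  have [measurable]: "\<xi> \<in> P \<rightarrow>\<^sub>M vague_borel" using \<xi> by (simp add: random_measure_def)
  have [measurable]: "g \<in> borel_measurable vague_borel" using g by (rule continuous_map_measurable_vague_borel)
  have A: "{M \<in> lf_measures. g M \<noteq> 0} \<in> sets vague_borel"
    unfolding space_vague_borel[symmetric] by measurable
  let ?E = "{\<omega> \<in> space P. g (\<xi> \<omega>) \<noteq> 0}"
  have "(\<lambda>n. \<integral>\<omega>. min 1 (real n * \<bar>g (\<xi> \<omega>)\<bar>) \<partial>P) \<longlonglongrightarrow> (\<integral>\<omega>. indicator ?E \<omega> \<partial>P)"
  proof (rule integral_dominated_convergence[where w = "\<lambda>_. 1"])
    show "AE \<omega> in P. (\<lambda>n. min 1 (real n * \<bar>g (\<xi> \<omega>)\<bar>)) \<longlonglongrightarrow> indicator ?E \<omega>"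
    proof (rule AE_I2)
      fix \<omega> assume \<omega>: "\<omega> \<in> space P"
      show "(\<lambda>n. min 1 (real n * \<bar>g (\<xi> \<omega>)\<bar>)) \<longlonglongrightarrow> indicator ?E \<omega>"
      proof (cases "g (\<xi> \<omega>) = 0")
        case False
        obtain N :: nat where N: "1 / \<bar>g (\<xi> \<omega>)\<bar> \<le> real N" using real_arch_simple by blast
        have "min 1 (real n * \<bar>g (\<xi> \<omega>)\<bar>) = 1" if "N \<le> n" for n
        proof -
          have "1 / \<bar>g (\<xi> \<omega>)\<bar> \<le> real n" using N that by linarith
          then show ?thesis using False by (simp add: field_simps)
        qed
        then have "eventually (\<lambda>n. min 1 (real n * \<bar>g (\<xi> \<omega>)\<bar>) = 1) sequentially"
          by (auto simp: eventually_sequentially)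
        then show ?thesis using False \<omega> by (simp add: tendsto_eventually)
      qed simp
    qed
  qed auto
  moreover have "(\<integral>\<omega>. indicator ?E \<omega> \<partial>P) = measure P ?E" by simp
  moreover have "measure P ?E = measure (distr P vague_borel \<xi>) {M \<in> lf_measures. g M \<noteq> 0}"
    using random_measure_in_lf[OF \<xi>] by (subst measure_distr[OF _ A]) (auto intro!: arg_cong[where f = "measure P"])
  ultimately show ?thesis by simp
qed

text \<open>
  Cozero sets are stable under intersection and generate the Borel sets, and their probabilities
  are limits of expectations of bounded continuous functions.
\<close>
lemma distr_vague_borel_eqI:
  fixes \<xi> :: "'p \<Rightarrow> (real ^ 'n) measure"
  assumes \<xi>: "random_measure P \<xi>" and \<zeta>: "random_measure Q \<zeta>"
    and eq: "\<And>g. continuous_map vague_topology euclideanreal g \<Longrightarrow> bounded (g ` lf_measures) \<Longrightarrow>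
      (\<integral>\<omega>. g (\<xi> \<omega>) \<partial>P) = (\<integral>\<omega>. g (\<zeta> \<omega>) \<partial>Q)"
  shows "distr P vague_borel \<xi> = distr Q vague_borel \<zeta>"
proof -
  let ?V = "vague_topology :: (real ^ 'n) measure topology"
  let ?E = "{A. cozero_in ?V A}"
  interpret P: prob_space "distr P vague_borel \<xi>"
    using \<xi> unfolding random_measure_def by (auto intro: prob_space.prob_space_distr)
  interpret Q: prob_space "distr Q vague_borel \<zeta>"
    using \<zeta> unfolding random_measure_def by (auto intro: prob_space.prob_space_distr)
  show ?thesis
  proof (rule measure_eqI_generator_eq[where E = ?E and \<Omega> = lf_measures and A = "\<lambda>_. lf_measures"])
    show "Int_stable ?E" by (auto simp: Int_stable_def cozero_in_Int)
    show "?E \<subseteq> Pow lf_measures" by (auto simp: cozero_in_def topspace_vague_topology)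
    show "range (\<lambda>_. lf_measures) \<subseteq> ?E" using cozero_in_topspace[of ?V] by (auto simp: topspace_vague_topology)
    fix A assume "A \<in> ?E"
    then obtain g where g: "continuous_map ?V euclideanreal g" and A: "A = {M \<in> lf_measures. g M \<noteq> 0}"
      by (auto simp: cozero_in_def topspace_vague_topology)
    have "(\<integral>\<omega>. min 1 (real n * \<bar>g (\<xi> \<omega>)\<bar>) \<partial>P) = (\<integral>\<omega>. min 1 (real n * \<bar>g (\<zeta> \<omega>)\<bar>) \<partial>Q)" for n
    proof (rule eq)
      show "continuous_map ?V euclideanreal (\<lambda>M. min 1 (real n * \<bar>g M\<bar>))"
        by (intro continuous_map_real_min continuous_map_real_mult continuous_map_real_abs g) auto
      show "bounded ((\<lambda>M. min 1 (real n * \<bar>g M\<bar>)) ` lf_measures)"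
        unfolding bounded_iff by (intro exI[of _ 1]) (auto simp: abs_le_iff intro: order_trans[of _ 0])
    qed
    then have "measure (distr P vague_borel \<xi>) A = measure (distr Q vague_borel \<zeta>) A"
      using expectation_tendsto_cozero[OF \<xi> g] expectation_tendsto_cozero[OF \<zeta> g]
      unfolding A by (simp add: LIMSEQ_unique)
    then show "emeasure (distr P vague_borel \<xi>) A = emeasure (distr Q vague_borel \<zeta>) A"
      by (simp add: P.emeasure_eq_measure Q.emeasure_eq_measure)
  qed (auto simp: sets_vague_borel_cozero)
qed

section \<open>Scale invariance of the limit\<close>

text \<open>
  By the composition law, \<open>E g (dilate c (dilate t \<nu>))\<close> equals \<open>E g (dilate (c * t) \<nu>)\<close>. The former
  tends to \<open>E g (dilate c \<mu>)\<close> since \<open>g\<close> after dilation by \<open>c\<close> is a bounded continuous function, the latter to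
  \<open>E g \<mu>\<close> since \<open>c * t\<close> tends to infinity.
\<close>
lemma scale_invariant_limit:
  fixes \<nu> :: "'p \<Rightarrow> (real ^ 'n) measure"
  assumes \<nu>: "random_measure P \<nu>" and \<mu>: "random_measure Q \<mu>"
    and conv: "converges_in_distribution vague_topology P (\<lambda>t \<omega>. dilate t (\<nu> \<omega>)) at_top Q \<mu>"
  shows "scale_invariant Q \<mu>"
  unfolding scale_invariant_def
proof (intro allI impI)
  fix c :: real assume c: "0 < c"
  show "distr Q vague_borel (\<lambda>\<omega>. dilate c (\<mu> \<omega>)) = distr Q vague_borel \<mu>"
  proof (rule distr_vague_borel_eqI[OF random_measure_dilate[OF \<mu> c] \<mu>])
    fix g :: "(real ^ 'n) measure \<Rightarrow> real"
    assume g: "continuous_map vague_topology euclideanreal g" "bounded (g ` lf_measures)"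
    have gc: "continuous_map vague_topology euclideanreal (\<lambda>M. g (dilate c M))"
      using continuous_map_compose[OF continuous_map_dilate[OF c] g(1)] by (simp add: comp_def)
    have "bounded ((\<lambda>M. g (dilate c M)) ` lf_measures)"
      using g(2) by (rule bounded_subset) (auto simp: dilate_in_lf_measures c)
    then have "((\<lambda>t. \<integral>\<omega>. g (dilate c (dilate t (\<nu> \<omega>))) \<partial>P) \<longlongrightarrow> (\<integral>\<omega>. g (dilate c (\<mu> \<omega>)) \<partial>Q)) at_top"
      using conv gc unfolding converges_in_distribution_def topspace_vague_topology by auto
    moreover have "eventually (\<lambda>t. (\<integral>\<omega>. g (dilate c (dilate t (\<nu> \<omega>))) \<partial>P) = (\<integral>\<omega>. g (dilate (c * t) (\<nu> \<omega>)) \<partial>P)) at_top"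
      using eventually_gt_at_top[of "0::real"]
      by eventually_elim (auto intro!: Bochner_Integration.integral_cong simp: dilate_dilate c random_measure_in_lf[OF \<nu>])
    ultimately have "((\<lambda>t. \<integral>\<omega>. g (dilate (c * t) (\<nu> \<omega>)) \<partial>P) \<longlongrightarrow> (\<integral>\<omega>. g (dilate c (\<mu> \<omega>)) \<partial>Q)) at_top"
      by (rule Lim_transform_eventually)
    moreover have "((\<lambda>t. \<integral>\<omega>. g (dilate (c * t) (\<nu> \<omega>)) \<partial>P) \<longlongrightarrow> (\<integral>\<omega>. g (\<mu> \<omega>) \<partial>Q)) at_top"
    proof (rule filterlim_compose[of "\<lambda>t. \<integral>\<omega>. g (dilate t (\<nu> \<omega>)) \<partial>P" _ at_top])
      show "((\<lambda>t. \<integral>\<omega>. g (dilate t (\<nu> \<omega>)) \<partial>P) \<longlongrightarrow> (\<integral>\<omega>. g (\<mu> \<omega>) \<partial>Q)) at_top"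
        using conv g unfolding converges_in_distribution_def topspace_vague_topology by auto
      show "filterlim (\<lambda>t. c * t) at_top at_top"
        using c by (intro filterlim_tendsto_pos_mult_at_top[OF tendsto_const]) (auto simp: filterlim_ident)
    qed
    ultimately show "(\<integral>\<omega>. g (dilate c (\<mu> \<omega>)) \<partial>Q) = (\<integral>\<omega>. g (\<mu> \<omega>) \<partial>Q)"
      by (intro tendsto_unique[OF trivial_limit_at_top_linorder])
  qed
qed

theorem lemma2p1:
  fixes s :: "nat \<Rightarrow> real"
    and P :: "'p measure" and \<nu> :: "'p \<Rightarrow> (real ^ 'n) measure"
    and Q :: "'q measure" and \<mu> :: "'q \<Rightarrow> (real ^ 'n) measure"
  assumes "\<And>n. s n > 0"
    and "incseq s"
    and "filterlim s at_top sequentially"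
    and "(\<lambda>n. s n / s (Suc n)) \<longlonglongrightarrow> 1"
    and "random_measure P \<nu>" and "finite_intensity P \<nu>"
    and "random_measure Q \<mu>" and "finite_intensity Q \<mu>"
    and "converges_in_distribution vague_topology P (\<lambda>n \<omega>. dilate (s n) (\<nu> \<omega>)) sequentially Q \<mu>"
  shows "converges_in_distribution vague_topology P (\<lambda>t \<omega>. dilate t (\<nu> \<omega>)) at_top Q \<mu> \<and>
    scale_invariant Q \<mu>"
proof
  show conv: "converges_in_distribution vague_topology P (\<lambda>t \<omega>. dilate t (\<nu> \<omega>)) at_top Q \<mu>"
    using assms(1-5,7,9) by (rule converges_in_distribution_along_reals)
  show "scale_invariant Q \<mu>"
    using assms(5,7) conv by (rule scale_invariant_limit)
qed

end
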